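(* Suppose that Assumptions (I), (II), (III) and (IV) listed in the context hold. Then the following statements hold. (a) There exist a unique constant $g^*$, a function $u^*\in B_W(\mathbb N_0\times\mathbb N_0)$, and a stationary policy $\beta^*\in\mathscr U_{SM}$ satisfying the average-cost optimality equation: for all $(n,i)\in\mathbb N_0\times\mathbb N_0$, $$g^*=\inf_{a\in[\gamma,R]}\Big\{r(n,i,a)+\sum_{(m,j)}u^*(m,j)\,\pi^{a}_{(n,i)(m,j)}\Big\}=r(n,i,\beta^*(n,i))+\sum_{(m,j)}u^*(m,j)\,\pi^{\beta^*}_{(n,i)(m,j)} .$$ (b) The policy $\beta^*$ in (a) is PAC-optimal, and $P^{\beta^*}_{(n,i)}\big(J_c(n,i,\beta^* )=g^*\big)=1$ for all $(n,i)\in\mathbb N_0\times\mathbb N_0$, with $g^*$ as in (a). (c) A policy in $\mathscr U_{SM}$ is PAC-optimal if and only if it realizes the minimum in the average-cost optimality equation in (a) (for every $(n,i)$). (d) Let $\varepsilon\ge0$, $\beta\in\mathscr U_{SM}$, and let $g^*$ be as in (a). If there is a function $u'\in B_W(\mathbb N_0\times\mathbb N_0)$ such that $$g^*\ge r(n,i,\beta(n,i))+\sum_{(m,j)}u'(m,j)\,\pi^{\beta}_{(n,i)(m,j)}-\varepsilon\qquad\text{for all }(n,i)\in\mathbb N_0\times\mathbb N_0,$$ then $\beta$ is $\varepsilon$-PAC-optimal.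
   Context: Notation: $\mathbb N_0=\{0,1,2,\dots\}$; $\delta_{(n,i)(m,j)}$ is the Kronecker delta on $\mathbb N_0\times\mathbb N_0$; sums over $(m,j)$ run over $\mathbb N_0\times\mathbb N_0$. Control model: $\lambda,\mu>0$ and $0<\gamma\le R<\infty$ are constants. The state space is $\mathbb N_0\times\mathbb N_0$ (state $(n,i)$: $n$ customers, $i$ items in inventory), the action space in every state is $[\gamma,R]$ (production rates). For $a\in[\gamma,R]$ the transition rates are: $\pi^{a}_{(n,i)(n,i+1)}=a$ for all $n,i\ge0$; $\pi^{a}_{(n,i)(n+1,i)}=\lambda$ for $n\ge0,i\ge1$; $\pi^{a}_{(n,i)(n-1,i-1)}=\mu$ for $n,i\ge1$; all other off-diagonal rates are $0$; and $\pi^{a}_{(n,i)(n,i)}=-\sum_{(m,j)\ne(n,i)}\pi^a_{(n,i)(m,j)}$. Put $\pi^*_{(n,i)}:=\sup_{a\in[\gamma,R]}\big(-\pi^{a}_{(n,i)(n,i)}\big)$. The cost rate is $r(n,i,a)=c_0\, i+c_1 n+a\,c_2\,\mathbf 1_{\{i>S\}}+c_3\,n\,\mathbf 1_{\{i=0\}}$ with constants $c_0,c_1,c_2,c_3\ge0$ and $S\in\mathbb N_0$. Policies: $\mathscr U_{SM}$ is the set of all functions $\beta:\mathbb N_0\times\mathbb N_0\to[\gamma,R]$ (deterministic stationary policies). For $\beta\in\mathscr U_{SM}$, write $\pi^\beta_{(n,i)(m,j)}=\pi^{\beta(n,i)}_{(n,i)(m,j)}$, let $Y(t)$ be the right-continuous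 Markov chain with these rates, and let $P^\beta_{(n,i)},E^\beta_{(n,i)}$ be the probability and expectation when $Y(0)=(n,i)$. Pathwise average cost (PAC) criterion: $J_c(n,i,\beta):=\limsup_{T\to\infty}\frac1T\int_0^T r(Y(t),\beta(Y(t-)))\,dt$, a random variable under $P^\beta_{(n,i)}$. For $\varepsilon\ge0$, a policy $\hat\beta\in\mathscr U_{SM}$ is $\varepsilon$-PAC-optimal if there is a constant $\hat g$ such that $P^{\hat\beta}_{(n,i)}(J_c(n,i,\hat\beta)\le \hat g+\varepsilon)=1$ and $P^\beta_{(n,i)}(J_c(n,i,\beta)\ge \hat g)=1$ for all $(n,i)$ and all $\beta\in\mathscr U_{SM}$; PAC-optimal means $0$-PAC-optimal. Weighted space: for $V\ge1$, $\|u\|_V=\sup_{(n,i)}|u(n,i)|/V(n,i)$ and $B_V(\mathbb N_0\times\mathbb N_0)=\{u:\mathbb N_0\times\mathbb N_0\to\mathbb R:\|u\|_V<\infty\}$. Assumption (I): there are a function $W\ge1$ on $\mathbb N_0\times\mathbb N_0$, nondecreasing along some fixed enumeration of $\mathbb N_0\times\mathbb N_0$, and constants $\bar c_1>0$, $\bar b_1\ge0$, $M>0$ such that for all $(n,i)$ and $a\in[\gamma,R]$: $\sum_{(m,j)}\pi^{a}_{(n,i)(m,j)}W(m,j)\le-\bar c_1W(n,i)+\bar b_1\delta_{(n,i)(0,0)}$ and $r(n,i,a)\le M\,W(n,i)$. Under (I), for each $\beta\in\mathscr U_{SM}$ the (irreducible) chain $Y$ has a unique invariant probability measure $\vartheta_\beta$,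 and $\vartheta_\beta(u):=\sum_{(m,j)}u(m,j)\vartheta_\beta(m,j)$ is finite for $u\in B_W(\mathbb N_0\times\mathbb N_0)$. Assumption (II): with $W$ as in (I), there are a nonnegative function $W'$ on $\mathbb N_0\times\mathbb N_0$ and constants $c'>0$, $b'\ge0$, $M'>0$ such that for all $(n,i)$ and $a\in[\gamma,R]$: $\pi^*_{(n,i)}W(n,i)\le M'W'(n,i)$ and $\sum_{(m,j)}\pi^{a}_{(n,i)(m,j)}W'(m,j)\le c'W'(n,i)+b'$. Assumption (III) (uniform ergodicity): with $W$ as in (I), there are constants $\delta>0$, $L_2>0$ such that $\sup_{\beta\in\mathscr U_{SM}}|E^\beta_{(n,i)}u(Y(t))-\vartheta_\beta(u)|\le L_2e^{-\delta t}\|u\|_W W(n,i)$ for all $(n,i)$, all $u\in B_W(\mathbb N_0\times\mathbb N_0)$ and all $t\ge0$. Assumption (IV): with $W$ as in (I), for $k=1,2$ there are functions $W_k^*\ge1$ on $\mathbb N_0\times\mathbb N_0$ and constants $c_k^*>0$, $b_k^*\ge0$, $M_k^*>0$ such that for all $(n,i)$ and $a\in[\gamma,R]$: $W^2(n,i)\le M_1^*W_1^*(n,i)$, $[\pi^*_{(n,i)}W(n,i)]^2\le M_2^*W_2^*(n,i)$, and $\sum_{(m,j)}\pi^a_{(n,i)(m,j)}W_k^*(m,j)\le-c_k^*W_k^*(n,i)+b_k^*$ for $k=1,2$. *)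

theory Defs
  imports "HOL-Probability.Probability"
begin

text \<open>A state \<open>(n, i)\<close> consists of \<open>n\<close> customers and \<open>i\<close> items in inventory.\<close>

type_synonym state = "nat \<times> nat"

fun jump_rate :: "real \<Rightarrow> real \<Rightarrow> real \<Rightarrow> state \<Rightarrow> state \<Rightarrow> real" where
  "jump_rate lam mu a (n, i) (m, j) =
     (if m = n \<and> j = i + 1 then a
      else if m = n + 1 \<and> j = i \<and> i \<ge> 1 then lam
      else if n = m + 1 \<and> i = j + 1 then mu
      else 0)"

definition rate :: "real \<Rightarrow> real \<Rightarrow> real \<Rightarrow> state \<Rightarrow> state \<Rightarrow> real" where
  "rate lam mu a x y =
     (if y = x then - (\<Sum>\<^sub>\<infinity>z\<in>- {x}. jump_rate lam mu a x z) else jump_rate lam mu a x y)"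

fun cost :: "real \<Rightarrow> real \<Rightarrow> real \<Rightarrow> real \<Rightarrow> nat \<Rightarrow> state \<Rightarrow> real \<Rightarrow> real" where
  "cost c0 c1 c2 c3 S (n, i) a =
     c0 * real i + c1 * real n + a * c2 * of_bool (i > S) + c3 * real n * of_bool (i = 0)"

text \<open>From here on \<open>q a x y\<close> are action-dependent transition rates, \<open>r x a\<close> is a cost rate and
  \<open>A\<close> is the set of actions (the same in every state).\<close>

definition max_exit_rate :: "(real \<Rightarrow> state \<Rightarrow> state \<Rightarrow> real) \<Rightarrow> real set \<Rightarrow> state \<Rightarrow> real" where
  "max_exit_rate q A x = (SUP a\<in>A. - q a x x)"

definition drift :: "(real \<Rightarrow> state \<Rightarrow> state \<Rightarrow> real) \<Rightarrow> (state \<Rightarrow> real) \<Rightarrow> real \<Rightarrow> state \<Rightarrow> real" where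
  "drift q u a x = (\<Sum>\<^sub>\<infinity>y. q a x y * u y)"

definition policies :: "real set \<Rightarrow> (state \<Rightarrow> real) set" where
  "policies A = {\<beta>. \<forall>x. \<beta> x \<in> A}"

definition policy_rate ::
  "(real \<Rightarrow> state \<Rightarrow> state \<Rightarrow> real) \<Rightarrow> (state \<Rightarrow> real) \<Rightarrow> state \<Rightarrow> state \<Rightarrow> real" where
  "policy_rate q \<beta> x y = q (\<beta> x) x y"

text \<open>
  The chain with rate matrix \<open>Q\<close> is given by its jump chain and holding times.  An elementary
  event is a stream of pairs \<open>(e\<^sub>k, F\<^sub>k)\<close>, independent and identically distributed, where
  \<open>e\<^sub>k\<close> is a standard exponential variable and \<open>F\<^sub>k\<close> is a random map on the states, independent
  of \<open>e\<^sub>k\<close>, whose values \<open>F\<^sub>k x\<close> are independent with \<open>P(F\<^sub>k x = y) = Q x y / (- Q x x)\<close> for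
  \<open>y \<noteq> x\<close>.  In state \<open>x\<close> the \<open>k\<close>-th step takes time \<open>e\<^sub>k / (- Q x x)\<close>, which is exponentially
  distributed with parameter \<open>- Q x x\<close>, and leads to \<open>F\<^sub>k x\<close>.  The initial state is an argument
  of the process rather than of the measure.
\<close>

type_synonym path_event = "(real \<times> (state \<Rightarrow> state)) stream"

definition jump_pmf :: "(state \<Rightarrow> state \<Rightarrow> real) \<Rightarrow> state \<Rightarrow> state pmf" where
  "jump_pmf Q x = embed_pmf (\<lambda>y. if y = x then 0 else Q x y / (- Q x x))"

definition path_measure :: "(state \<Rightarrow> state \<Rightarrow> real) \<Rightarrow> path_event measure" where
  "path_measure Q =
     stream_space (density lborel (exponential_density 1) \<Otimes>\<^sub>M
       PiM UNIV (\<lambda>x. measure_pmf (jump_pmf Q x)))"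

primrec jump_chain :: "state \<Rightarrow> path_event \<Rightarrow> nat \<Rightarrow> state" where
  "jump_chain x \<omega> 0 = x"
| "jump_chain x \<omega> (Suc k) = snd (\<omega> !! k) (jump_chain x \<omega> k)"

definition jump_time :: "(state \<Rightarrow> state \<Rightarrow> real) \<Rightarrow> state \<Rightarrow> path_event \<Rightarrow> nat \<Rightarrow> real" where
  "jump_time Q x \<omega> k =
     (\<Sum>j<k. fst (\<omega> !! j) / (- Q (jump_chain x \<omega> j) (jump_chain x \<omega> j)))"

text \<open>\<open>chain Q x \<omega> t\<close> is \<open>Y(t)\<close> with \<open>Y(0) = x\<close>.  The value is unspecified at times \<open>t\<close> that are
  not exceeded by any jump time; for bounded rates this happens only on a null set.\<close>

definition chain :: "(state \<Rightarrow> state \<Rightarrow> real) \<Rightarrow> state \<Rightarrow> path_event \<Rightarrow> real \<Rightarrow> state" where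
  "chain Q x \<omega> t = jump_chain x \<omega> (LEAST k. t < jump_time Q x \<omega> (Suc k))"

definition invariant_pmf :: "(state \<Rightarrow> state \<Rightarrow> real) \<Rightarrow> state pmf \<Rightarrow> bool" where
  "invariant_pmf Q p \<longleftrightarrow>
     (\<forall>t\<ge>0. \<forall>y. measure_pmf.expectation p
        (\<lambda>x. \<P>(\<omega> in path_measure Q. chain Q x \<omega> t = y)) = pmf p y)"

definition stationary_pmf :: "(state \<Rightarrow> state \<Rightarrow> real) \<Rightarrow> state pmf" where
  "stationary_pmf Q = (THE p. invariant_pmf Q p)"

text \<open>\<open>wnorm V u\<close> is meaningful only if \<open>u \<in> weighted_space V\<close>, i.e. if the supremum is finite.\<close>

definition wnorm :: "(state \<Rightarrow> real) \<Rightarrow> (state \<Rightarrow> real) \<Rightarrow> real" where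
  "wnorm V u = (SUP x. \<bar>u x\<bar> / V x)"

definition weighted_space :: "(state \<Rightarrow> real) \<Rightarrow> (state \<Rightarrow> real) set" where
  "weighted_space V = {u. bdd_above (range (\<lambda>x. \<bar>u x\<bar> / V x))}"

definition pathwise_cost ::
  "(real \<Rightarrow> state \<Rightarrow> state \<Rightarrow> real) \<Rightarrow> (state \<Rightarrow> real \<Rightarrow> real) \<Rightarrow>
     (state \<Rightarrow> real) \<Rightarrow> state \<Rightarrow> path_event \<Rightarrow> ereal" where
  "pathwise_cost q r \<beta> x \<omega> =
     (let Y = chain (policy_rate q \<beta>) x \<omega> in
      Limsup at_top (\<lambda>T. ereal (1 / T * (LBINT t:{0..T}. r (Y t) (\<beta> (Lim (at_left t) Y))))))"

definition eps_PAC_optimal ::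
  "(real \<Rightarrow> state \<Rightarrow> state \<Rightarrow> real) \<Rightarrow> (state \<Rightarrow> real \<Rightarrow> real) \<Rightarrow> real set \<Rightarrow>
     real \<Rightarrow> (state \<Rightarrow> real) \<Rightarrow> bool" where
  "eps_PAC_optimal q r A \<epsilon> \<beta> \<longleftrightarrow> \<beta> \<in> policies A \<and>
     (\<exists>g::real.
        (\<forall>x. AE \<omega> in path_measure (policy_rate q \<beta>). pathwise_cost q r \<beta> x \<omega> \<le> ereal (g + \<epsilon>)) \<and>
        (\<forall>\<beta>'\<in>policies A. \<forall>x.
           AE \<omega> in path_measure (policy_rate q \<beta>'). pathwise_cost q r \<beta>' x \<omega> \<ge> ereal g))"

abbreviation PAC_optimal ::
  "(real \<Rightarrow> state \<Rightarrow> state \<Rightarrow> real) \<Rightarrow> (state \<Rightarrow> real \<Rightarrow> real) \<Rightarrow> real set \<Rightarrow>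
     (state \<Rightarrow> real) \<Rightarrow> bool" where
  "PAC_optimal q r A \<equiv> eps_PAC_optimal q r A 0"

definition assumption_I ::
  "(real \<Rightarrow> state \<Rightarrow> state \<Rightarrow> real) \<Rightarrow> (state \<Rightarrow> real \<Rightarrow> real) \<Rightarrow> real set \<Rightarrow>
     (state \<Rightarrow> real) \<Rightarrow> bool" where
  "assumption_I q r A W \<longleftrightarrow>
     (\<forall>x. W x \<ge> 1) \<and>
     (\<exists>e :: nat \<Rightarrow> state. bij e \<and> mono (\<lambda>k. W (e k))) \<and>
     (\<exists>c>0. \<exists>b\<ge>0. \<exists>M>0. \<forall>x. \<forall>a\<in>A.
        drift q W a x \<le> - c * W x + b * of_bool (x = (0, 0)) \<and> r x a \<le> M * W x)"

definition assumption_II ::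
  "(real \<Rightarrow> state \<Rightarrow> state \<Rightarrow> real) \<Rightarrow> real set \<Rightarrow> (state \<Rightarrow> real) \<Rightarrow> bool" where
  "assumption_II q A W \<longleftrightarrow>
     (\<exists>W'. (\<forall>x. W' x \<ge> 0) \<and>
       (\<exists>c>0. \<exists>b\<ge>0. \<exists>M>0. \<forall>x. \<forall>a\<in>A.
          max_exit_rate q A x * W x \<le> M * W' x \<and> drift q W' a x \<le> c * W' x + b))"

definition assumption_III ::
  "(real \<Rightarrow> state \<Rightarrow> state \<Rightarrow> real) \<Rightarrow> real set \<Rightarrow> (state \<Rightarrow> real) \<Rightarrow> bool" where
  "assumption_III q A W \<longleftrightarrow>
     (\<exists>\<delta>>0. \<exists>L>0. \<forall>x. \<forall>u\<in>weighted_space W. \<forall>t\<ge>0. \<forall>\<beta>\<in>policies A.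
        \<bar>(\<integral>\<omega>. u (chain (policy_rate q \<beta>) x \<omega> t) \<partial>path_measure (policy_rate q \<beta>))
           - measure_pmf.expectation (stationary_pmf (policy_rate q \<beta>)) u\<bar>
        \<le> L * exp (- \<delta> * t) * wnorm W u * W x)"

definition assumption_IV ::
  "(real \<Rightarrow> state \<Rightarrow> state \<Rightarrow> real) \<Rightarrow> real set \<Rightarrow> (state \<Rightarrow> real) \<Rightarrow> bool" where
  "assumption_IV q A W \<longleftrightarrow>
     (\<exists>W1. (\<forall>x. W1 x \<ge> 1) \<and>
       (\<exists>c>0. \<exists>b\<ge>0. \<exists>M>0. \<forall>x. \<forall>a\<in>A.
          (W x)\<^sup>2 \<le> M * W1 x \<and> drift q W1 a x \<le> - c * W1 x + b)) \<and>
     (\<exists>W2. (\<forall>x. W2 x \<ge> 1) \<and>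
       (\<exists>c>0. \<exists>b\<ge>0. \<exists>M>0. \<forall>x. \<forall>a\<in>A.
          (max_exit_rate q A x * W x)\<^sup>2 \<le> M * W2 x \<and> drift q W2 a x \<le> - c * W2 x + b))"

definition realizes_minimum ::
  "(real \<Rightarrow> state \<Rightarrow> state \<Rightarrow> real) \<Rightarrow> (state \<Rightarrow> real \<Rightarrow> real) \<Rightarrow> real set \<Rightarrow>
     (state \<Rightarrow> real) \<Rightarrow> (state \<Rightarrow> real) \<Rightarrow> bool" where
  "realizes_minimum q r A u \<beta> \<longleftrightarrow>
     (\<forall>x. (INF a\<in>A. r x a + drift q u a x) = r x (\<beta> x) + drift q u (\<beta> x) x)"

definition ACOE ::
  "(real \<Rightarrow> state \<Rightarrow> state \<Rightarrow> real) \<Rightarrow> (state \<Rightarrow> real \<Rightarrow> real) \<Rightarrow> real set \<Rightarrow>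
     real \<Rightarrow> (state \<Rightarrow> real) \<Rightarrow> (state \<Rightarrow> real) \<Rightarrow> bool" where
  "ACOE q r A g u \<beta> \<longleftrightarrow>
     (\<forall>x. g = (INF a\<in>A. r x a + drift q u a x)) \<and> realizes_minimum q r A u \<beta>"

end

theory Submission
  imports Defs "HOL-Library.Discrete_Functions"
begin

text \<open>
  \<^bold>\<open>Vanishing time averages.\<close>  For a policy \<open>\<beta>\<close> and a function \<open>u\<close> that is bounded by a multiple of
  \<open>W\<close>, let \<open>L u\<close> be the generator of the chain applied to \<open>u\<close>.  Almost surely the time averages of
  \<open>L u\<close> along the path tend to \<open>0\<close> (\<open>time_average_generator\<close>).  Indeed, the increments of \<open>u\<close> along
  the jump chain minus the integrals of \<open>L u\<close> over the holding periods are centred given the past.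
  As \<open>W\<^sup>2\<close> is dominated by a function with negative drift, their second moments are bounded, and a
  strong law of large numbers (\<open>AE_path_sum_tendsto\<close>) applies to their sums.

  \<^bold>\<open>Costs.\<close>  Hence, if the cost rate plus \<open>L u\<close> is everywhere at most \<open>g\<close> (at least \<open>g\<close>), then so is
  the pathwise average cost, almost surely.  With a solution of the optimality equation this makes
  \<open>g\<close> a lower bound under every policy and an upper bound under a minimizing one; the uniqueness of
  \<open>g\<close>, the optimality of minimizing policies and the \<open>\<epsilon>\<close>-version follow.

  \<^bold>\<open>Necessity.\<close>  The same law applied to \<open>W\<close> shows that the chain spends a positive fraction of time at
  the origin, and applied to indicators of single states it carries this property along every
  transition, so that every state is visited for a positive fraction of time (\<open>occupied_all\<close>).  A
  policy that misses the minimum at one state therefore has a strictly larger pathwise cost.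

  \<^bold>\<open>Existence.\<close>  Exit rates are bounded, so the equation can be uniformized.  By the drift condition
  the dynamic programming operator that prescribes the value \<open>0\<close> at the origin is a contraction in
  the \<open>W\<close>-norm.  Its fixed point solves the equation with a prescribed constant \<open>g\<close> off the origin,
  and depends on \<open>g\<close> continuously and monotonically; the intermediate value theorem provides a \<open>g\<close>
  for which the equation also holds at the origin (\<open>ex_balanced_gain\<close>).
\<close>

section \<open>Laws of large numbers along the jump chain\<close>

lemma AE_tendsto_zero_of_summable_second_moments:
  fixes f :: "nat \<Rightarrow> 'a \<Rightarrow> real"
  assumes meas: "\<And>n. f n \<in> borel_measurable M"
    and bound: "\<And>n. (\<integral>\<^sup>+\<omega>. ennreal ((f n \<omega>)\<^sup>2) \<partial>M) \<le> ennreal (B n)"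
    and B: "\<And>n. 0 \<le> B n" "summable B"
  shows "AE \<omega> in M. (\<lambda>n. f n \<omega>) \<longlonglongrightarrow> 0"
proof -
  note [measurable] = meas
  have "(\<integral>\<^sup>+\<omega>. (\<Sum>n. ennreal ((f n \<omega>)\<^sup>2)) \<partial>M) = (\<Sum>n. \<integral>\<^sup>+\<omega>. ennreal ((f n \<omega>)\<^sup>2) \<partial>M)"
    by (rule nn_integral_suminf) measurable
  also have "\<dots> \<le> (\<Sum>n. ennreal (B n))"
    by (intro suminf_le bound) auto
  also have "\<dots> = ennreal (suminf B)"
    using B by (simp add: suminf_ennreal2)
  finally have "(\<integral>\<^sup>+\<omega>. (\<Sum>n. ennreal ((f n \<omega>)\<^sup>2)) \<partial>M) \<noteq> \<infinity>"
    by (auto simp: top_unique)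
  then have "AE \<omega> in M. (\<Sum>n. ennreal ((f n \<omega>)\<^sup>2)) \<noteq> \<infinity>"
    by (intro nn_integral_PInf_AE) auto
  then show ?thesis
  proof eventually_elim
    fix \<omega> assume "(\<Sum>n. ennreal ((f n \<omega>)\<^sup>2)) \<noteq> \<infinity>"
    then have "summable (\<lambda>n. (f n \<omega>)\<^sup>2)"
      by (intro summable_suminf_not_top) auto
    then have "(\<lambda>n. (f n \<omega>)\<^sup>2) \<longlonglongrightarrow> 0" by (rule summable_LIMSEQ_zero)
    from tendsto_real_sqrt[OF this] show "(\<lambda>n. f n \<omega>) \<longlonglongrightarrow> 0"
      by (simp add: tendsto_rabs_zero_iff)
  qed
qed

text \<open>Averages that converge along the squares converge, provided that the fluctuations between
  consecutive squares are negligible.\<close>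

lemma averages_tendsto_zero_of_squares:
  fixes a :: "nat \<Rightarrow> real"
  assumes sq: "(\<lambda>m. (\<Sum>k<m\<^sup>2. a k) / real (m\<^sup>2)) \<longlonglongrightarrow> 0"
    and gap: "(\<lambda>m. (\<Sum>k\<in>{m\<^sup>2..<(Suc m)\<^sup>2}. \<bar>a k\<bar>) / real (m\<^sup>2)) \<longlonglongrightarrow> 0"
  shows "(\<lambda>n. (\<Sum>k<n. a k) / real n) \<longlonglongrightarrow> 0"
proof -
  define f where "f m = \<bar>(\<Sum>k<m\<^sup>2. a k) / real (m\<^sup>2)\<bar> + (\<Sum>k\<in>{m\<^sup>2..<(Suc m)\<^sup>2}. \<bar>a k\<bar>) / real (m\<^sup>2)" for m
  have "f \<longlonglongrightarrow> 0"
    unfolding f_def using tendsto_add[OF tendsto_rabs[OF sq] gap] by simp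
  moreover have "filterlim floor_sqrt at_top sequentially"
    unfolding filterlim_at_top
  proof
    fix Z show "\<forall>\<^sub>F n in sequentially. Z \<le> floor_sqrt n"
      using eventually_ge_at_top[of "Z\<^sup>2"] by eventually_elim (simp add: le_floor_sqrt_iff)
  qed
  ultimately have lim: "(\<lambda>n. f (floor_sqrt n)) \<longlonglongrightarrow> 0"
    by (rule filterlim_compose)
  show ?thesis
  proof (rule Lim_null_comparison[OF _ lim])
    show "\<forall>\<^sub>F n in sequentially. norm ((\<Sum>k<n. a k) / real n) \<le> f (floor_sqrt n)"
      using eventually_gt_at_top[of 0]
    proof eventually_elim
      fix n :: nat assume n: "0 < n"
      define m where "m = floor_sqrt n"
      have m: "0 < m" "m\<^sup>2 \<le> n" "n < (Suc m)\<^sup>2"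
        using n Suc_floor_sqrt_power2_gt[of n] by (auto simp: m_def)
      have split: "{..<n} = {..<m\<^sup>2} \<union> {m\<^sup>2..<n}" using m by auto
      have "(\<Sum>k<n. a k) = (\<Sum>k<m\<^sup>2. a k) + (\<Sum>k\<in>{m\<^sup>2..<n}. a k)"
        unfolding split by (rule sum.union_disjoint) auto
      also have "\<bar>\<dots>\<bar> \<le> \<bar>\<Sum>k<m\<^sup>2. a k\<bar> + (\<Sum>k\<in>{m\<^sup>2..<n}. \<bar>a k\<bar>)"
        by (rule order_trans[OF abs_triangle_ineq]) simp
      also have "\<dots> \<le> \<bar>\<Sum>k<m\<^sup>2. a k\<bar> + (\<Sum>k\<in>{m\<^sup>2..<(Suc m)\<^sup>2}. \<bar>a k\<bar>)"
        using m by (intro add_left_mono sum_mono2) auto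
      finally have "\<bar>\<Sum>k<n. a k\<bar> / real n \<le>
          (\<bar>\<Sum>k<m\<^sup>2. a k\<bar> + (\<Sum>k\<in>{m\<^sup>2..<(Suc m)\<^sup>2}. \<bar>a k\<bar>)) / real (m\<^sup>2)"
        using m n of_nat_mono[OF m(2), where 'a=real]
        by (intro frac_le) (auto simp: sum_nonneg simp del: of_nat_power)
      then show "norm ((\<Sum>k<n. a k) / real n) \<le> f (floor_sqrt n)"
        by (simp add: f_def m_def add_divide_distrib)
    qed
  qed
qed

lemma (in prob_space) square_integrable_of_nn_bound:
  fixes f :: "'a \<Rightarrow> real"
  assumes [measurable]: "f \<in> borel_measurable M"
    and "(\<integral>\<^sup>+\<omega>. ennreal ((f \<omega>)\<^sup>2) \<partial>M) \<le> ennreal C"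
  shows "integrable M (\<lambda>\<omega>. (f \<omega>)\<^sup>2)" "integrable M f"
proof -
  show "integrable M (\<lambda>\<omega>. (f \<omega>)\<^sup>2)"
    by (rule integrableI_nonneg) (use assms in \<open>auto intro: le_less_trans\<close>)
  then show "integrable M f" by (rule square_integrable_imp_integrable[rotated]) auto
qed

lemma (in prob_space) stream_space_unfold:
  "distr (M \<Otimes>\<^sub>M stream_space M) (stream_space M) (\<lambda>(a, \<omega>). a ## \<omega>) = stream_space M"
proof (rule measure_eqI)
  interpret S: prob_space "stream_space M" by (rule prob_space_stream_space)
  fix X assume "X \<in> sets (distr (M \<Otimes>\<^sub>M stream_space M) (stream_space M) (\<lambda>(a, \<omega>). a ## \<omega>))"
  then have [measurable]: "X \<in> sets (stream_space M)" by simp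
  have "emeasure (distr (M \<Otimes>\<^sub>M stream_space M) (stream_space M) (\<lambda>(a, \<omega>). a ## \<omega>)) X =
     (\<integral>\<^sup>+p. indicator X (case p of (a, \<omega>) \<Rightarrow> a ## \<omega>) \<partial>(M \<Otimes>\<^sub>M stream_space M))"
    by (subst nn_integral_indicator[symmetric], simp, subst nn_integral_distr) auto
  also have "\<dots> = (\<integral>\<^sup>+a. \<integral>\<^sup>+\<omega>. indicator X (a ## \<omega>) \<partial>stream_space M \<partial>M)"
    by (subst S.nn_integral_fst[symmetric]) auto
  also have "\<dots> = (\<integral>\<^sup>+\<omega>. indicator X \<omega> \<partial>stream_space M)"
    by (rule nn_integral_stream_space[symmetric]) auto
  finally show "emeasure (distr (M \<Otimes>\<^sub>M stream_space M) (stream_space M) (\<lambda>(a, \<omega>). a ## \<omega>)) X =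
    emeasure (stream_space M) X" by simp
qed simp

lemma (in prob_space) integral_stream_space:
  fixes f :: "'a stream \<Rightarrow> real"
  assumes f: "integrable (stream_space M) f"
  shows "(\<integral>\<omega>. f \<omega> \<partial>stream_space M) = (\<integral>a. (\<integral>\<omega>. f (a ## \<omega>) \<partial>stream_space M) \<partial>M)"
proof -
  interpret S: prob_space "stream_space M" by (rule prob_space_stream_space)
  interpret P: pair_prob_space M "stream_space M" ..
  have fm[measurable]: "f \<in> borel_measurable (stream_space M)" using f by auto
  have "integrable (distr (M \<Otimes>\<^sub>M stream_space M) (stream_space M) (\<lambda>(a, \<omega>). a ## \<omega>)) f"
    using f by (simp only: stream_space_unfold)
  then have int: "integrable (M \<Otimes>\<^sub>M stream_space M) (\<lambda>p. f (case p of (a, \<omega>) \<Rightarrow> a ## \<omega>))"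
    by (rule integrable_distr[rotated]) simp
  have "(\<integral>\<omega>. f \<omega> \<partial>stream_space M) =
    (\<integral>\<omega>. f \<omega> \<partial>distr (M \<Otimes>\<^sub>M stream_space M) (stream_space M) (\<lambda>(a, \<omega>). a ## \<omega>))"
    by (simp only: stream_space_unfold)
  also have "\<dots> = (\<integral>p. f (case p of (a, \<omega>) \<Rightarrow> a ## \<omega>) \<partial>(M \<Otimes>\<^sub>M stream_space M))"
    by (rule integral_distr) auto
  also have "\<dots> = (\<integral>a. \<integral>\<omega>. f (a ## \<omega>) \<partial>stream_space M \<partial>M)"
    using P.integral_fst'[OF int] by simp
  finally show ?thesis .
qed

lemma jump_chain_Stream: "jump_chain x (a ## \<omega>) (Suc k) = jump_chain (snd a x) \<omega> k"
  by (induction k) auto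

text \<open>\<open>path_sum \<phi> x \<omega> n\<close> is the sum of \<open>\<phi>\<close> over the first \<open>n\<close> steps of the jump chain from \<open>x\<close>;
  a summand may depend on the state before the step and on the whole random step, that is, on the
  exponential variable and on the map that produces the next state.\<close>

definition path_sum ::
  "(state \<Rightarrow> real \<times> (state \<Rightarrow> state) \<Rightarrow> real) \<Rightarrow> state \<Rightarrow> path_event \<Rightarrow> nat \<Rightarrow> real" where
  "path_sum \<phi> x \<omega> n = (\<Sum>k<n. \<phi> (jump_chain x \<omega> k) (\<omega> !! k))"

lemma path_sum_Stream:
  "path_sum \<phi> x (a ## \<omega>) (Suc n) = \<phi> x a + path_sum \<phi> (snd a x) \<omega> n"
  unfolding path_sum_def
  by (subst sum.lessThan_Suc_shift) (simp add: jump_chain_Stream del: jump_chain.simps(2))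

text \<open>A chain driven by independent steps with distribution \<open>N\<close>, together with a function \<open>V\<close> that
  contracts in mean up to a constant, so that the means of \<open>V\<close> along the chain stay bounded.\<close>

locale stream_walk = prob_space N for N :: "(real \<times> (state \<Rightarrow> state)) measure" +
  fixes V :: "state \<Rightarrow> real" and \<rho> b :: real
  assumes measurable_next[measurable]: "\<And>x. (\<lambda>a. snd a x) \<in> N \<rightarrow>\<^sub>M count_space UNIV"
    and V_ge_1: "\<And>x. 1 \<le> V x"
    and rho: "0 < \<rho>" "\<rho> < 1" and b_nonneg: "0 \<le> b"
    and drift_V: "\<And>x. (\<integral>\<^sup>+a. ennreal (V (snd a x)) \<partial>N) \<le> ennreal (\<rho> * V x + b)"
begin

abbreviation "paths \<equiv> stream_space N"

sublocale paths: prob_space paths by (rule prob_space_stream_space)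

lemma V_nonneg: "0 \<le> V x" using V_ge_1[of x] by simp

lemma measurable_jump_chain[measurable]: "(\<lambda>\<omega>. jump_chain x \<omega> k) \<in> paths \<rightarrow>\<^sub>M count_space UNIV"
proof (induction k)
  case (Suc k)
  have "(\<lambda>\<omega>. snd (\<omega> !! k) y) \<in> paths \<rightarrow>\<^sub>M count_space UNIV" for y
    by (rule measurable_compose[OF measurable_snth measurable_next])
  from measurable_compose_countable[OF this Suc] show ?case by simp
qed simp

lemma measurable_at_step:
  assumes "\<And>y. \<phi> y \<in> borel_measurable N"
  shows "(\<lambda>\<omega>. \<phi> (jump_chain x \<omega> k) (\<omega> !! k)) \<in> borel_measurable paths"
proof -
  have "(\<lambda>\<omega>. \<phi> y (\<omega> !! k)) \<in> borel_measurable paths" for y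
    by (rule measurable_compose[OF measurable_snth assms])
  from measurable_compose_countable[OF this measurable_jump_chain] show ?thesis .
qed

lemma measurable_path_sum:
  assumes "\<And>y. \<phi> y \<in> borel_measurable N"
  shows "(\<lambda>\<omega>. path_sum \<phi> x \<omega> n) \<in> borel_measurable paths"
  unfolding path_sum_def by (intro borel_measurable_sum measurable_at_step assms)

text \<open>An upper bound, uniform in \<open>k\<close>, for the mean of \<open>V\<close> after \<open>k\<close> steps from \<open>x\<close>.\<close>

definition V_bound :: "state \<Rightarrow> real" where "V_bound x = V x + b / (1 - \<rho>)"

lemma V_bound_nonneg: "0 \<le> V_bound x"
  using V_nonneg[of x] rho b_nonneg by (simp add: V_bound_def)

text \<open>The second moment of \<open>\<phi>\<close> at the \<open>k\<close>-th step is bounded uniformly in \<open>k\<close>.\<close>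

lemma nn_integral_at_step:
  assumes meas: "\<And>y. \<phi> y \<in> borel_measurable N" and K: "0 \<le> K"
    and bound: "\<And>y. (\<integral>\<^sup>+a. ennreal ((\<phi> y a)\<^sup>2) \<partial>N) \<le> ennreal (K * V y)"
  shows "(\<integral>\<^sup>+\<omega>. ennreal ((\<phi> (jump_chain x \<omega> k) (\<omega> !! k))\<^sup>2) \<partial>paths) \<le> ennreal (K * V_bound x)"
proof -
  define B where "B = b / (1 - \<rho>)"
  have B: "0 \<le> B" "b = B * (1 - \<rho>)" using rho b_nonneg by (auto simp: B_def)
  note [measurable] = meas
  have "(\<integral>\<^sup>+\<omega>. ennreal ((\<phi> (jump_chain x \<omega> k) (\<omega> !! k))\<^sup>2) \<partial>paths)
      \<le> ennreal (K * (\<rho> ^ k * V x + (1 - \<rho> ^ k) * B))"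
  proof (induction k arbitrary: x)
    case 0
    have "(\<integral>\<^sup>+\<omega>. ennreal ((\<phi> x (\<omega> !! 0))\<^sup>2) \<partial>paths) = (\<integral>\<^sup>+a. ennreal ((\<phi> x a)\<^sup>2) \<partial>N)"
      by (subst nn_integral_stream_space) (auto simp: paths.emeasure_space_1 simp del: snth.simps(2))
    with bound[of x] show ?case by simp
  next
    case (Suc k)
    have p: "0 \<le> 1 - \<rho> ^ k" "0 \<le> \<rho> ^ k"
      using rho by (auto intro: power_le_one)
    have "(\<integral>\<^sup>+\<omega>. ennreal ((\<phi> (jump_chain x \<omega> (Suc k)) (\<omega> !! Suc k))\<^sup>2) \<partial>paths) =
      (\<integral>\<^sup>+a. \<integral>\<^sup>+\<omega>. ennreal ((\<phi> (jump_chain (snd a x) \<omega> k) (\<omega> !! k))\<^sup>2) \<partial>paths \<partial>N)"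
      by (subst nn_integral_stream_space)
        (auto simp: jump_chain_Stream simp del: jump_chain.simps(2)
              intro!: borel_measurable_power measurable_compose[OF _ measurable_ennreal] measurable_at_step)
    also have "\<dots> \<le> (\<integral>\<^sup>+a. ennreal (K * (\<rho> ^ k * V (snd a x) + (1 - \<rho> ^ k) * B)) \<partial>N)"
      by (intro nn_integral_mono Suc.IH)
    also have "\<dots> = (\<integral>\<^sup>+a. ennreal (K * \<rho> ^ k) * ennreal (V (snd a x)) + ennreal (K * ((1 - \<rho> ^ k) * B)) \<partial>N)"
      using K p B(1) V_nonneg
      by (intro nn_integral_cong) (simp add: distrib_left ennreal_mult mult.assoc)
    also have "\<dots> = ennreal (K * \<rho> ^ k) * (\<integral>\<^sup>+a. ennreal (V (snd a x)) \<partial>N) + ennreal (K * ((1 - \<rho> ^ k) * B))"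
      by (subst nn_integral_add) (auto simp: nn_integral_cmult emeasure_space_1)
    also have "\<dots> \<le> ennreal (K * \<rho> ^ k) * ennreal (\<rho> * V x + b) + ennreal (K * ((1 - \<rho> ^ k) * B))"
      by (intro add_mono mult_left_mono drift_V) auto
    also have "\<dots> = ennreal (K * \<rho> ^ k * (\<rho> * V x + b) + K * ((1 - \<rho> ^ k) * B))"
      using K p B(1) V_nonneg[of x] rho b_nonneg by (simp add: ennreal_mult)
    also have "K * \<rho> ^ k * (\<rho> * V x + b) + K * ((1 - \<rho> ^ k) * B) =
       K * (\<rho> ^ Suc k * V x + (1 - \<rho> ^ Suc k) * B)"
      unfolding B(2) by (simp add: algebra_simps)
    finally show ?case .
  qed
  also have "\<dots> \<le> ennreal (K * V_bound x)"
  proof (intro ennreal_leI mult_left_mono K)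
    have "\<rho> ^ k * V x \<le> V x" "(1 - \<rho> ^ k) * B \<le> B"
      using rho V_nonneg[of x] B(1)
      by (auto intro!: mult_left_le_one_le power_le_one)
    then show "\<rho> ^ k * V x + (1 - \<rho> ^ k) * B \<le> V_bound x" unfolding V_bound_def B_def by simp
  qed
  finally show ?thesis .
qed

lemma AE_at_step_tendsto:
  assumes meas: "\<And>y. \<phi> y \<in> borel_measurable N" and K: "0 \<le> K"
    and bound: "\<And>y. (\<integral>\<^sup>+a. ennreal ((\<phi> y a)\<^sup>2) \<partial>N) \<le> ennreal (K * V y)"
  shows "AE \<omega> in paths. (\<lambda>n. \<phi> (jump_chain x \<omega> n) (\<omega> !! n) / real n) \<longlonglongrightarrow> 0"
proof (rule AE_tendsto_zero_of_summable_second_moments)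
  show "(\<lambda>\<omega>. \<phi> (jump_chain x \<omega> n) (\<omega> !! n) / real n) \<in> borel_measurable paths" for n
    by (intro borel_measurable_divide measurable_at_step meas) auto
  show "summable (\<lambda>n. K * V_bound x * (1 / real n ^ 2))"
    using inverse_power_summable[of 2, where 'a=real]
    by (intro summable_mult) (simp add: field_simps)
  show "0 \<le> K * V_bound x * (1 / real n ^ 2)" for n
    using K V_bound_nonneg by simp
  fix n
  have "(\<integral>\<^sup>+\<omega>. ennreal ((\<phi> (jump_chain x \<omega> n) (\<omega> !! n) / real n)\<^sup>2) \<partial>paths) =
     (\<integral>\<^sup>+\<omega>. ennreal (1 / real n ^ 2) * ennreal ((\<phi> (jump_chain x \<omega> n) (\<omega> !! n))\<^sup>2) \<partial>paths)"
    by (intro nn_integral_cong) (simp add: ennreal_mult[symmetric] power_divide)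
  also have "\<dots> = ennreal (1 / real n ^ 2) * (\<integral>\<^sup>+\<omega>. ennreal ((\<phi> (jump_chain x \<omega> n) (\<omega> !! n))\<^sup>2) \<partial>paths)"
    by (rule nn_integral_cmult)
      (intro borel_measurable_power measurable_compose[OF _ measurable_ennreal] measurable_at_step meas)
  also have "\<dots> \<le> ennreal (1 / real n ^ 2) * ennreal (K * V_bound x)"
    by (intro mult_left_mono nn_integral_at_step assms) auto
  also have "\<dots> = ennreal (K * V_bound x * (1 / real n ^ 2))"
    using K V_bound_nonneg[of x] by (simp add: ennreal_mult[symmetric] mult.commute)
  finally show "(\<integral>\<^sup>+\<omega>. ennreal ((\<phi> (jump_chain x \<omega> n) (\<omega> !! n) / real n)\<^sup>2) \<partial>paths)
    \<le> ennreal (K * V_bound x * (1 / real n ^ 2))" .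
qed

text \<open>For centred summands the cross terms vanish, so the second moment grows only linearly.  The
  induction on \<open>n\<close> conditions on the first step; the term \<open>A * V x\<close> absorbs the contribution of the
  first summand because \<open>V\<close> contracts by the factor \<open>\<rho>\<close>.\<close>

lemma path_sum_second_moment:
  assumes meas: "\<And>y. \<phi> y \<in> borel_measurable N" and K: "0 \<le> K"
    and bound: "\<And>y. (\<integral>\<^sup>+a. ennreal ((\<phi> y a)\<^sup>2) \<partial>N) \<le> ennreal (K * V y)"
    and centred: "\<And>y. (\<integral>a. \<phi> y a \<partial>N) = 0"
  defines "A \<equiv> K / (1 - \<rho>)"
  shows "(\<integral>\<^sup>+\<omega>. ennreal ((path_sum \<phi> x \<omega> n)\<^sup>2) \<partial>paths) \<le> ennreal (A * V x + A * b * real n)"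
    and "(\<integral>\<omega>. path_sum \<phi> x \<omega> n \<partial>paths) = 0"
proof -
  have A: "0 \<le> A" "K = A * (1 - \<rho>)" using K rho by (auto simp: A_def)
  note [measurable] = meas measurable_path_sum[OF meas]
  have "(\<integral>\<^sup>+\<omega>. ennreal ((path_sum \<phi> x \<omega> n)\<^sup>2) \<partial>paths) \<le> ennreal (A * V x + A * b * real n) \<and>
    (\<integral>\<omega>. path_sum \<phi> x \<omega> n \<partial>paths) = 0"
  proof (induction n arbitrary: x)
    case 0
    show ?case by (simp add: path_sum_def)
  next
    case (Suc n)
    note sq = paths.square_integrable_of_nn_bound[OF measurable_path_sum[OF meas] conjunct1[OF Suc.IH]]
    have inner: "(\<integral>\<^sup>+\<omega>. ennreal ((c + path_sum \<phi> y \<omega> n)\<^sup>2) \<partial>paths) \<le>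
        ennreal (c\<^sup>2) + ennreal (A * V y + A * b * real n)" for c y
    proof -
      have "(\<integral>\<^sup>+\<omega>. ennreal ((c + path_sum \<phi> y \<omega> n)\<^sup>2) \<partial>paths) =
         ennreal (\<integral>\<omega>. (c + path_sum \<phi> y \<omega> n)\<^sup>2 \<partial>paths)"
      proof (rule nn_integral_eq_integral)
        show "integrable paths (\<lambda>\<omega>. (c + path_sum \<phi> y \<omega> n)\<^sup>2)"
          unfolding power2_sum using sq[of y] by auto
      qed simp
      also have "(\<integral>\<omega>. (c + path_sum \<phi> y \<omega> n)\<^sup>2 \<partial>paths) = c\<^sup>2 + (\<integral>\<omega>. (path_sum \<phi> y \<omega> n)\<^sup>2 \<partial>paths)"
        using sq[of y] conjunct2[OF Suc.IH[of y]] by (simp add: power2_sum paths.prob_space)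
      also have "ennreal \<dots> = ennreal (c\<^sup>2) + (\<integral>\<^sup>+\<omega>. ennreal ((path_sum \<phi> y \<omega> n)\<^sup>2) \<partial>paths)"
        using sq[of y] by (simp add: nn_integral_eq_integral)
      also have "\<dots> \<le> ennreal (c\<^sup>2) + ennreal (A * V y + A * b * real n)"
        using Suc.IH[of y] by (intro add_mono) auto
      finally show ?thesis .
    qed
    have "(\<integral>\<^sup>+\<omega>. ennreal ((path_sum \<phi> x \<omega> (Suc n))\<^sup>2) \<partial>paths) =
      (\<integral>\<^sup>+a. \<integral>\<^sup>+\<omega>. ennreal ((\<phi> x a + path_sum \<phi> (snd a x) \<omega> n)\<^sup>2) \<partial>paths \<partial>N)"
      by (subst nn_integral_stream_space) (auto simp: path_sum_Stream)
    also have "\<dots> \<le> (\<integral>\<^sup>+a. ennreal ((\<phi> x a)\<^sup>2) + ennreal (A * V (snd a x) + A * b * real n) \<partial>N)"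
      by (intro nn_integral_mono inner)
    also have "\<dots> = (\<integral>\<^sup>+a. ennreal ((\<phi> x a)\<^sup>2) + (ennreal A * ennreal (V (snd a x)) + ennreal (A * b * real n)) \<partial>N)"
      using A V_nonneg b_nonneg by (intro nn_integral_cong) (simp add: ennreal_mult)
    also have "\<dots> = (\<integral>\<^sup>+a. ennreal ((\<phi> x a)\<^sup>2) \<partial>N) +
        (ennreal A * (\<integral>\<^sup>+a. ennreal (V (snd a x)) \<partial>N) + ennreal (A * b * real n))"
      by (simp add: nn_integral_add nn_integral_cmult emeasure_space_1)
    also have "\<dots> \<le> ennreal (K * V x) + (ennreal A * ennreal (\<rho> * V x + b) + ennreal (A * b * real n))"
      by (intro add_mono bound mult_left_mono drift_V) auto
    also have "\<dots> = ennreal (K * V x + (A * (\<rho> * V x + b) + A * b * real n))"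
      using K A(1) V_nonneg[of x] rho b_nonneg by (simp add: ennreal_mult)
    also have "K * V x + (A * (\<rho> * V x + b) + A * b * real n) = A * V x + A * b * real (Suc n)"
      unfolding A(2) by (simp add: algebra_simps)
    finally have 1: "(\<integral>\<^sup>+\<omega>. ennreal ((path_sum \<phi> x \<omega> (Suc n))\<^sup>2) \<partial>paths) \<le> ennreal (A * V x + A * b * real (Suc n))" .
    have "(\<integral>\<omega>. path_sum \<phi> x \<omega> (Suc n) \<partial>paths) =
      (\<integral>a. \<integral>\<omega>. \<phi> x a + path_sum \<phi> (snd a x) \<omega> n \<partial>paths \<partial>N)"
      using paths.square_integrable_of_nn_bound(2)[OF measurable_path_sum[OF meas] 1]
      by (subst integral_stream_space) (simp_all add: path_sum_Stream)
    also have "\<dots> = (\<integral>a. \<phi> x a \<partial>N)"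
      using sq Suc.IH by (intro Bochner_Integration.integral_cong) (auto simp: paths.prob_space)
    finally show ?case using 1 centred by simp
  qed
  then show "(\<integral>\<^sup>+\<omega>. ennreal ((path_sum \<phi> x \<omega> n)\<^sup>2) \<partial>paths) \<le> ennreal (A * V x + A * b * real n)"
    "(\<integral>\<omega>. path_sum \<phi> x \<omega> n \<partial>paths) = 0" by auto
qed

text \<open>A strong law of large numbers.  Second moments of order \<open>n\<close> are summable after division by
  \<open>n\<^sup>2\<close> only along the squares; the gap between \<open>m\<^sup>2\<close> and \<open>(m + 1)\<^sup>2\<close> has about \<open>2 m\<close> terms and is
  controlled by the Cauchy-Schwarz inequality.\<close>

lemma AE_path_sum_tendsto:
  assumes meas: "\<And>y. \<phi> y \<in> borel_measurable N" and K: "0 \<le> K"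
    and bound: "\<And>y. (\<integral>\<^sup>+a. ennreal ((\<phi> y a)\<^sup>2) \<partial>N) \<le> ennreal (K * V y)"
    and centred: "\<And>y. (\<integral>a. \<phi> y a \<partial>N) = 0"
  shows "AE \<omega> in paths. (\<lambda>n. path_sum \<phi> x \<omega> n / real n) \<longlonglongrightarrow> 0"
proof -
  note [measurable] = measurable_at_step[OF meas] measurable_path_sum[OF meas]
  define A where "A = K / (1 - \<rho>)"
  have A: "0 \<le> A" using K rho by (simp add: A_def)
  have inv: "summable (\<lambda>m. C * (1 / real m ^ 2))" for C
    using inverse_power_summable[of 2, where 'a=real]
    by (intro summable_mult) (simp add: field_simps)
  have "AE \<omega> in paths. (\<lambda>m. path_sum \<phi> x \<omega> (m\<^sup>2) / real (m\<^sup>2)) \<longlonglongrightarrow> 0"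
  proof (rule AE_tendsto_zero_of_summable_second_moments)
    show "summable (\<lambda>m. (A * V x + A * b) * (1 / real m ^ 2))" by (rule inv)
    show "0 \<le> (A * V x + A * b) * (1 / real m ^ 2)" for m
      using A V_nonneg[of x] b_nonneg by simp
    fix m
    have "(\<integral>\<^sup>+\<omega>. ennreal ((path_sum \<phi> x \<omega> (m\<^sup>2) / real (m\<^sup>2))\<^sup>2) \<partial>paths) =
       (\<integral>\<^sup>+\<omega>. ennreal (1 / real m ^ 4) * ennreal ((path_sum \<phi> x \<omega> (m\<^sup>2))\<^sup>2) \<partial>paths)"
      by (intro nn_integral_cong) (simp add: ennreal_mult[symmetric] power_divide flip: power_mult)
    also have "\<dots> = ennreal (1 / real m ^ 4) * (\<integral>\<^sup>+\<omega>. ennreal ((path_sum \<phi> x \<omega> (m\<^sup>2))\<^sup>2) \<partial>paths)"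
      by (rule nn_integral_cmult) measurable
    also have "\<dots> \<le> ennreal (1 / real m ^ 4) * ennreal (A * V x + A * b * real (m\<^sup>2))"
      unfolding A_def by (intro mult_left_mono path_sum_second_moment assms) auto
    also have "\<dots> = ennreal (1 / real m ^ 4 * (A * V x + A * b * real (m\<^sup>2)))"
      using A V_nonneg[of x] b_nonneg by (intro ennreal_mult[symmetric]) auto
    also have "\<dots> \<le> ennreal ((A * V x + A * b) * (1 / real m ^ 2))"
    proof (cases "m = 0")
      case False
      have "A * V x + A * b * real (m\<^sup>2) \<le> (A * V x + A * b) * real (m\<^sup>2)"
        using A V_nonneg[of x] False mult_right_mono[of 1 "real (m\<^sup>2)" "A * V x"]
        by (simp add: algebra_simps)
      then have "1 / real m ^ 4 * (A * V x + A * b * real (m\<^sup>2)) \<le>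
          1 / real m ^ 4 * ((A * V x + A * b) * real (m\<^sup>2))"
        by (intro mult_left_mono) auto
      also have "\<dots> = (A * V x + A * b) * (1 / real m ^ 2)"
        using False by (simp add: field_simps flip: power_add)
      finally show ?thesis by (rule ennreal_leI)
    qed simp
    finally show "(\<integral>\<^sup>+\<omega>. ennreal ((path_sum \<phi> x \<omega> (m\<^sup>2) / real (m\<^sup>2))\<^sup>2) \<partial>paths)
       \<le> ennreal ((A * V x + A * b) * (1 / real m ^ 2))" .
  qed measurable
  moreover have "AE \<omega> in paths. (\<lambda>m. (\<Sum>k\<in>{m\<^sup>2..<(Suc m)\<^sup>2}. \<bar>\<phi> (jump_chain x \<omega> k) (\<omega> !! k)\<bar>) / real (m\<^sup>2)) \<longlonglongrightarrow> 0"
  proof (rule AE_tendsto_zero_of_summable_second_moments)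
    show "summable (\<lambda>m. (9 * (K * V_bound x)) * (1 / real m ^ 2))" by (rule inv)
    show "0 \<le> (9 * (K * V_bound x)) * (1 / real m ^ 2)" for m
      using K V_bound_nonneg[of x] by simp
    fix m
    let ?I = "{m\<^sup>2..<(Suc m)\<^sup>2}"
    have card: "card ?I = 2 * m + 1" by (simp add: power2_eq_square)
    have "(\<integral>\<^sup>+\<omega>. ennreal (((\<Sum>k\<in>?I. \<bar>\<phi> (jump_chain x \<omega> k) (\<omega> !! k)\<bar>) / real (m\<^sup>2))\<^sup>2) \<partial>paths) \<le>
       (\<integral>\<^sup>+\<omega>. ennreal ((2 * m + 1) / real m ^ 4) * (\<Sum>k\<in>?I. ennreal ((\<phi> (jump_chain x \<omega> k) (\<omega> !! k))\<^sup>2)) \<partial>paths)"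
    proof (intro nn_integral_mono)
      fix \<omega>
      have "(\<Sum>k\<in>?I. \<bar>\<phi> (jump_chain x \<omega> k) (\<omega> !! k)\<bar>)\<^sup>2 \<le>
         (\<Sum>k\<in>?I. (\<phi> (jump_chain x \<omega> k) (\<omega> !! k))\<^sup>2) * real (2 * m + 1)"
        using sum_squared_le_sum_of_squares[of "\<lambda>k. \<bar>\<phi> (jump_chain x \<omega> k) (\<omega> !! k)\<bar>" ?I] unfolding card by simp
      then have "((\<Sum>k\<in>?I. \<bar>\<phi> (jump_chain x \<omega> k) (\<omega> !! k)\<bar>) / real (m\<^sup>2))\<^sup>2 \<le>
        (2 * m + 1) / real m ^ 4 * (\<Sum>k\<in>?I. (\<phi> (jump_chain x \<omega> k) (\<omega> !! k))\<^sup>2)"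
        by (simp add: power_divide divide_right_mono mult.commute flip: power_mult)
      then show "ennreal (((\<Sum>k\<in>?I. \<bar>\<phi> (jump_chain x \<omega> k) (\<omega> !! k)\<bar>) / real (m\<^sup>2))\<^sup>2) \<le>
        ennreal ((2 * m + 1) / real m ^ 4) * (\<Sum>k\<in>?I. ennreal ((\<phi> (jump_chain x \<omega> k) (\<omega> !! k))\<^sup>2))"
        by (subst sum_ennreal) (auto simp: ennreal_mult[symmetric] sum_nonneg intro!: ennreal_leI)
    qed
    also have "\<dots> = ennreal ((2 * m + 1) / real m ^ 4) *
        (\<Sum>k\<in>?I. \<integral>\<^sup>+\<omega>. ennreal ((\<phi> (jump_chain x \<omega> k) (\<omega> !! k))\<^sup>2) \<partial>paths)"
      by (subst nn_integral_cmult, measurable, subst nn_integral_sum, measurable)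
    also have "\<dots> \<le> ennreal ((2 * m + 1) / real m ^ 4) * (\<Sum>k\<in>?I. ennreal (K * V_bound x))"
      by (intro mult_left_mono sum_mono nn_integral_at_step assms) auto
    also have "\<dots> = ennreal ((2 * m + 1) / real m ^ 4 * (real (2 * m + 1) * (K * V_bound x)))"
    proof -
      have "(\<Sum>k\<in>?I. ennreal (K * V_bound x)) = ennreal (real (2 * m + 1) * (K * V_bound x))"
        unfolding sum_constant card using K V_bound_nonneg[of x]
        by (simp add: ennreal_of_nat_eq_real_of_nat ennreal_mult' del: of_nat_add of_nat_mult)
      then show ?thesis
        using K V_bound_nonneg[of x] by (simp only:) (intro ennreal_mult[symmetric], auto)
    qed
    also have "\<dots> \<le> ennreal ((9 * (K * V_bound x)) * (1 / real m ^ 2))"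
    proof (cases "m = 0")
      case False
      have "real (2 * m + 1) * real (2 * m + 1) \<le> (3 * real m) * (3 * real m)"
        using False by (intro mult_mono) auto
      then have "(2 * m + 1) / real m ^ 4 * (real (2 * m + 1) * (K * V_bound x)) \<le>
          (1 / real m ^ 4) * ((9 * real m ^ 2) * (K * V_bound x))"
        using mult_right_mono[of "real (2 * m + 1) * real (2 * m + 1)" "9 * real m ^ 2" "K * V_bound x / real m ^ 4"]
          K V_bound_nonneg[of x]
        by (simp add: power2_eq_square mult_ac)
      also have "\<dots> = (9 * (K * V_bound x)) * (1 / real m ^ 2)"
        using False by (simp add: field_simps flip: power_add)
      finally show ?thesis by (rule ennreal_leI)
    qed simp
    finally show "(\<integral>\<^sup>+\<omega>. ennreal (((\<Sum>k\<in>?I. \<bar>\<phi> (jump_chain x \<omega> k) (\<omega> !! k)\<bar>) / real (m\<^sup>2))\<^sup>2) \<partial>paths)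
      \<le> ennreal ((9 * (K * V_bound x)) * (1 / real m ^ 2))" .
  qed measurable
  ultimately show ?thesis
    by eventually_elim (unfold path_sum_def, rule averages_tendsto_zero_of_squares)
qed

end

section \<open>Time integrals along a path\<close>

lemma piecewise_constant_at_jump:
  fixes T :: "nat \<Rightarrow> real"
  assumes T: "strict_mono T" and t: "T k \<le> t" "t < T (Suc k)"
  shows "(LEAST k. t < T (Suc k)) = k"
proof (rule Least_equality)
  fix j assume "t < T (Suc j)"
  then have "T k < T (Suc j)" using t by simp
  then show "k \<le> j" using strict_mono_less[OF T] by simp
qed (rule t)

text \<open>The integrand and the step function in the proof differ at most at the jump times and
  at \<open>t0\<close>.  In particular the left limit may be replaced by the current state.\<close>

lemma piecewise_constant_integral:
  fixes T :: "nat \<Rightarrow> real" and X :: "nat \<Rightarrow> state" and h :: "state \<Rightarrow> state \<Rightarrow> real"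
  assumes T: "strict_mono T" and T0: "T 0 = 0" and t0: "T k \<le> t0" "t0 < T (Suc k)"
  defines "Y \<equiv> \<lambda>t. X (LEAST k. t < T (Suc k))"
  shows "(LBINT t:{0..t0}. h (Y t) (Lim (at_left t) Y)) =
    (\<Sum>j<k. (T (Suc j) - T j) * h (X j) (X j)) + (t0 - T k) * h (X k) (X k)"
proof -
  have mono: "T i \<le> T j" if "i \<le> j" for i j
    using strict_mono_less_eq[OF T] that by simp
  have Y: "Y s = X j" if "T j \<le> s" "s < T (Suc j)" for s j
    unfolding Y_def piecewise_constant_at_jump[OF T that] ..
  have L: "Lim (at_left s) Y = X j" if "T j < s" "s < T (Suc j)" for s j
  proof (rule tendsto_Lim)
    have "\<forall>\<^sub>F s' in at_left s. Y s' = X j"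
      using eventually_at_left_real[OF that(1)] by eventually_elim (use that in \<open>auto intro!: Y\<close>)
    then show "(Y \<longlongrightarrow> X j) (at_left s)" by (rule tendsto_eventually)
  qed simp
  let ?g = "\<lambda>t. (\<Sum>j<k. h (X j) (X j) * indicator {T j<..<T (Suc j)} t) + h (X k) (X k) * indicator {T k<..<t0} t"
  have "has_bochner_integral lborel ?g
     ((\<Sum>j<k. h (X j) (X j) * measure lborel {T j<..<T (Suc j)}) + h (X k) (X k) * measure lborel {T k<..<t0})"
    using mono t0
    by (intro has_bochner_integral_add has_bochner_integral_sum has_bochner_integral_mult_right
          has_bochner_integral_real_indicator) auto
  also have "(\<Sum>j<k. h (X j) (X j) * measure lborel {T j<..<T (Suc j)}) + h (X k) (X k) * measure lborel {T k<..<t0} =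
    (\<Sum>j<k. (T (Suc j) - T j) * h (X j) (X j)) + (t0 - T k) * h (X k) (X k)"
    using mono t0 by (simp add: mult.commute)
  also have "has_bochner_integral lborel ?g \<dots> \<longleftrightarrow>
     has_bochner_integral lborel (\<lambda>t. indicator {0..t0} t *\<^sub>R h (Y t) (Lim (at_left t) Y)) \<dots>"
  proof (rule has_bochner_integral_discrete_difference[where X = "range T \<union> {t0}"])
    fix t assume t: "t \<notin> range T \<union> {t0}"
    show "?g t = indicator {0..t0} t *\<^sub>R h (Y t) (Lim (at_left t) Y)"
    proof (cases "0 < t \<and> t < t0")
      case True
      define i where "i = (LEAST j. t < T (Suc j))"
      have ti: "t < T (Suc i)"
        unfolding i_def by (rule LeastI[of _ k]) (use True t0 in simp)
      have ik: "i \<le> k" unfolding i_def by (rule Least_le) (use True t0 in simp)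
      have "T i \<le> t"
      proof (cases i)
        case 0
        then show ?thesis using True T0 by simp
      next
        case (Suc i')
        then have "\<not> t < T (Suc i')" using not_less_Least[of i' "\<lambda>j. t < T (Suc j)"] by (simp add: i_def)
        then show ?thesis using Suc by simp
      qed
      then have Ti: "T i < t" using t by (metis UnI1 le_less rangeI)
      have only: "indicator {T j<..<T (Suc j)} t = (if j = i then 1 else 0 :: real)" for j
      proof (cases "j = i")
        case False
        then consider "Suc j \<le> i" | "Suc i \<le> j" by linarith
        then have "t \<notin> {T j<..<T (Suc j)}"
        proof cases
          case 1 with mono[OF 1] Ti show ?thesis by simp
        next
          case 2 with mono[OF 2] ti show ?thesis by simp
        qed
        then show ?thesis using False by simp
      qed (use Ti ti in simp)
      have last: "indicator {T k<..<t0} t = (if k = i then 1 else 0 :: real)"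
      proof (cases "k = i")
        case False
        then have "T (Suc i) \<le> T k" using ik by (intro mono) simp
        then show ?thesis using False ti by (simp add: indicator_def)
      qed (use Ti True in simp)
      have "?g t = (\<Sum>j<k. if j = i then h (X i) (X i) else 0) + (if k = i then h (X i) (X i) else 0)"
        unfolding only last by (intro arg_cong2[where f = "(+)"] sum.cong) auto
      also have "\<dots> = h (X i) (X i)" using ik by simp
      also have "\<dots> = indicator {0..t0} t *\<^sub>R h (Y t) (Lim (at_left t) Y)"
        using True Y[of i t] L[of i t] Ti ti by simp
      finally show ?thesis .
    next
      case False
      have "indicator {T j<..<T (Suc j)} t = (0::real)" if "j < k" for j
        using False t0(1) mono[of 0 j] mono[of "Suc j" k] T0 that by (auto simp: indicator_def)
      moreover have "indicator {T k<..<t0} t = (0::real)"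
        using False mono[of 0 k] T0 by (simp add: indicator_def)
      moreover have "indicator {0..t0} t = (0::real)"
      proof -
        have "t \<noteq> 0" using t T0 by (metis UnI1 rangeI)
        then show ?thesis using False t by (auto simp: indicator_def)
      qed
      ultimately show ?thesis by simp
    qed
  qed auto
  finally show ?thesis
    unfolding set_lebesgue_integral_def by (rule has_bochner_integral_integral_eq)
qed

text \<open>The integral of a function of the state along the path, up to time \<open>t\<close>.\<close>

definition time_integral ::
  "(state \<Rightarrow> state \<Rightarrow> real) \<Rightarrow> state \<Rightarrow> path_event \<Rightarrow> (state \<Rightarrow> real) \<Rightarrow> real \<Rightarrow> real" where
  "time_integral Q x \<omega> f t = (LBINT s:{0..t}. f (chain Q x \<omega> s))"

lemma time_integral_cmult: "time_integral Q x \<omega> (\<lambda>y. c * f y) t = c * time_integral Q x \<omega> f t"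
  by (simp add: time_integral_def)

text \<open>Elementary events with positive holding times that satisfy the law of large numbers for the
  standard exponential variables.  For bounded rates, jump times then grow at least linearly, so that
  the path does not explode.\<close>

definition regular_event :: "path_event \<Rightarrow> bool" where
  "regular_event \<omega> \<longleftrightarrow> (\<forall>k. 0 < fst (\<omega> !! k)) \<and>
     (\<lambda>n. (\<Sum>k<n. fst (\<omega> !! k) - 1) / real n) \<longlonglongrightarrow> 0"

text \<open>Exit rates bounded from above and away from zero.\<close>

locale bounded_exit_rates =
  fixes Q :: "state \<Rightarrow> state \<Rightarrow> real" and lo hi :: real
  assumes lo: "0 < lo" and exit_rate: "\<And>x. lo \<le> - Q x x" "\<And>x. - Q x x \<le> hi"
begin

lemma hi_pos: "0 < hi" using lo exit_rate(1)[of undefined] exit_rate(2)[of undefined] by simp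

lemma exit_pos: "0 < - Q x x" using lo exit_rate(1)[of x] by simp

context
  fixes \<omega> assumes \<omega>: "regular_event \<omega>"
begin

lemma strict_mono_jump_time: "strict_mono (jump_time Q x \<omega>)"
proof (rule strict_monoI_Suc)
  fix n
  have "0 < fst (\<omega> !! n) / - Q (jump_chain x \<omega> n) (jump_chain x \<omega> n)"
    using \<omega> exit_pos by (intro divide_pos_pos) (auto simp: regular_event_def)
  then show "jump_time Q x \<omega> n < jump_time Q x \<omega> (Suc n)" by (simp add: jump_time_def)
qed

lemma jump_time_0: "jump_time Q x \<omega> 0 = 0" by (simp add: jump_time_def)

lemma jump_time_growth: "\<forall>\<^sub>F n in sequentially. real n / (2 * hi) \<le> jump_time Q x \<omega> n"
proof -
  have "\<forall>\<^sub>F n in sequentially. dist ((\<Sum>k<n. fst (\<omega> !! k) - 1) / real n) 0 < 1/2"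
    using \<omega> unfolding regular_event_def by (intro tendstoD) auto
  then show ?thesis using eventually_gt_at_top[of 0]
  proof eventually_elim
    case (elim n)
    have "- (1/2) < (\<Sum>k<n. fst (\<omega> !! k) - 1) / real n" using elim(1) unfolding dist_real_def by linarith
    then have "real n / 2 \<le> (\<Sum>k<n. fst (\<omega> !! k))" using elim(2)
      by (simp add: sum_subtractf field_simps)
    then have "real n / 2 / hi \<le> (\<Sum>k<n. fst (\<omega> !! k)) / hi"
      using hi_pos by (intro divide_right_mono) auto
    also have "\<dots> \<le> jump_time Q x \<omega> n"
      unfolding jump_time_def sum_divide_distrib
      using \<omega> exit_rate exit_pos hi_pos
      by (intro sum_mono divide_left_mono mult_pos_pos) (auto simp: regular_event_def less_imp_le)
    finally show ?case by simp
  qed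
qed

lemma jump_time_interval:
  assumes t: "0 \<le> t"
  obtains k where "jump_time Q x \<omega> k \<le> t" "t < jump_time Q x \<omega> (Suc k)"
proof -
  obtain N where N: "\<And>n. n \<ge> N \<Longrightarrow> real n / (2 * hi) \<le> jump_time Q x \<omega> n"
    using jump_time_growth unfolding eventually_sequentially by blast
  obtain m :: nat where m: "2 * hi * t < real m" using reals_Archimedean2 by blast
  have "t < real (Suc (max N m)) / (2 * hi)" using m hi_pos by (simp add: field_simps)
  also have "\<dots> \<le> jump_time Q x \<omega> (Suc (max N m))" by (rule N) simp
  finally have ex: "t < jump_time Q x \<omega> (Suc (max N m))" .
  define k where "k = (LEAST k. t < jump_time Q x \<omega> (Suc k))"
  have k: "t < jump_time Q x \<omega> (Suc k)" unfolding k_def using ex by (rule LeastI)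
  have "jump_time Q x \<omega> k \<le> t"
  proof (cases k)
    case (Suc k')
    then have "\<not> t < jump_time Q x \<omega> (Suc k')"
      using not_less_Least[of k' "\<lambda>j. t < jump_time Q x \<omega> (Suc j)"] by (simp add: k_def)
    then show ?thesis using Suc by simp
  qed (use t jump_time_0 in simp)
  with k show ?thesis by (rule that[rotated])
qed

lemma path_integral_eq:
  assumes k: "jump_time Q x \<omega> k \<le> t" "t < jump_time Q x \<omega> (Suc k)"
  shows "(LBINT s:{0..t}. h (chain Q x \<omega> s) (Lim (at_left s) (chain Q x \<omega>))) =
    (\<Sum>j<k. (fst (\<omega> !! j) / - Q (jump_chain x \<omega> j) (jump_chain x \<omega> j)) * h (jump_chain x \<omega> j) (jump_chain x \<omega> j)) +
    (t - jump_time Q x \<omega> k) * h (jump_chain x \<omega> k) (jump_chain x \<omega> k)"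
proof -
  have ch: "chain Q x \<omega> = (\<lambda>t. jump_chain x \<omega> (LEAST k. t < jump_time Q x \<omega> (Suc k)))"
    by (simp add: chain_def fun_eq_iff)
  have d: "jump_time Q x \<omega> (Suc j) - jump_time Q x \<omega> j = fst (\<omega> !! j) / - Q (jump_chain x \<omega> j) (jump_chain x \<omega> j)" for j
    by (simp add: jump_time_def)
  show ?thesis
    using piecewise_constant_integral[OF strict_mono_jump_time jump_time_0 k, of h "jump_chain x \<omega>"]
    unfolding ch d .
qed

lemmas time_integral_eq = path_integral_eq[where h = "\<lambda>y z. f y" for f, folded time_integral_def]

lemma path_integral_left_limit:
  assumes "0 \<le> t"
  shows "(LBINT s:{0..t}. h (chain Q x \<omega> s) (Lim (at_left s) (chain Q x \<omega>))) =
    time_integral Q x \<omega> (\<lambda>y. h y y) t"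
proof -
  obtain k where k: "jump_time Q x \<omega> k \<le> t" "t < jump_time Q x \<omega> (Suc k)"
    using jump_time_interval[OF assms] .
  show ?thesis unfolding path_integral_eq[OF k] time_integral_eq[OF k] ..
qed

lemma time_integral_mono:
  assumes "0 \<le> t" and "\<And>y. f y \<le> g y"
  shows "time_integral Q x \<omega> f t \<le> time_integral Q x \<omega> g t"
proof -
  obtain k where k: "jump_time Q x \<omega> k \<le> t" "t < jump_time Q x \<omega> (Suc k)"
    using jump_time_interval[OF assms(1)] .
  show ?thesis unfolding time_integral_eq[OF k]
  proof (intro add_mono sum_mono mult_left_mono assms(2))
    show "0 \<le> fst (\<omega> !! j) / - Q (jump_chain x \<omega> j) (jump_chain x \<omega> j)" for j
      using \<omega> by (intro divide_nonneg_nonneg less_imp_le exit_pos) (simp_all add: regular_event_def)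
  qed (use k in simp)
qed

lemma time_integral_add:
  assumes "0 \<le> t"
  shows "time_integral Q x \<omega> (\<lambda>y. f y + g y) t = time_integral Q x \<omega> f t + time_integral Q x \<omega> g t"
proof -
  obtain k where k: "jump_time Q x \<omega> k \<le> t" "t < jump_time Q x \<omega> (Suc k)"
    using jump_time_interval[OF assms] .
  show ?thesis unfolding time_integral_eq[OF k] by (simp add: sum.distrib distrib_left sum_subtractf sum_negf)
qed

lemma time_integral_const:
  assumes "0 \<le> t" shows "time_integral Q x \<omega> (\<lambda>y. c) t = c * t"
  using assms by (simp add: time_integral_def set_lebesgue_integral_def mult.commute)

text \<open>Sums over jumps control time averages: the time integral up to \<open>t\<close> is the sum over the \<open>k\<close>
  completed holding periods plus a part of the running one, and \<open>k\<close> is at most of order \<open>t\<close>.\<close>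

lemma time_average_tendsto_zero:
  assumes sum: "(\<lambda>n. (\<Sum>j<n. fst (\<omega> !! j) * (f (jump_chain x \<omega> j) / - Q (jump_chain x \<omega> j) (jump_chain x \<omega> j))) / real n) \<longlonglongrightarrow> 0"
    and last: "(\<lambda>n. fst (\<omega> !! n) * (f (jump_chain x \<omega> n) / - Q (jump_chain x \<omega> n) (jump_chain x \<omega> n)) / real n) \<longlonglongrightarrow> 0"
  shows "((\<lambda>t. time_integral Q x \<omega> f t / t) \<longlongrightarrow> 0) at_top"
proof (rule tendstoI)
  fix \<epsilon> :: real assume "0 < \<epsilon>"
  define F where "F j = fst (\<omega> !! j) * (f (jump_chain x \<omega> j) / - Q (jump_chain x \<omega> j) (jump_chain x \<omega> j))" for j
  have "(\<lambda>n. \<bar>(\<Sum>j<n. F j) / real n\<bar> + \<bar>F n / real n\<bar>) \<longlonglongrightarrow> 0"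
    using tendsto_add[OF tendsto_rabs[OF sum] tendsto_rabs[OF last]] by (simp add: F_def)
  moreover define \<delta> where "\<delta> = \<epsilon> / (4 * hi)"
  moreover have "0 < \<delta>" using \<open>0 < \<epsilon>\<close> hi_pos by (simp add: \<delta>_def)
  ultimately have "\<forall>\<^sub>F n in sequentially. \<bar>(\<Sum>j<n. F j) / real n\<bar> + \<bar>F n / real n\<bar> < \<delta>"
    by (auto dest!: tendstoD[of _ 0 _ \<delta>])
  from eventually_conj[OF eventually_conj[OF this jump_time_growth[of x]] eventually_gt_at_top[of 0]]
  obtain N where N: "\<And>n. n \<ge> N \<Longrightarrow> \<bar>(\<Sum>j<n. F j) / real n\<bar> + \<bar>F n / real n\<bar> < \<delta>"
      "\<And>n. n \<ge> N \<Longrightarrow> real n / (2 * hi) \<le> jump_time Q x \<omega> n" "\<And>n. n \<ge> N \<Longrightarrow> 0 < n"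
    unfolding eventually_sequentially by blast
  show "\<forall>\<^sub>F t in at_top. dist (time_integral Q x \<omega> f t / t) 0 < \<epsilon>"
    using eventually_ge_at_top[of "jump_time Q x \<omega> N"] eventually_gt_at_top[of 0]
  proof eventually_elim
    case (elim t)
    obtain k where k: "jump_time Q x \<omega> k \<le> t" "t < jump_time Q x \<omega> (Suc k)"
      using jump_time_interval[of t x] elim by auto
    have "jump_time Q x \<omega> N < jump_time Q x \<omega> (Suc k)" using elim k by simp
    then have Nk: "N \<le> k" using strict_mono_less[OF strict_mono_jump_time] by simp
    have kpos: "0 < k" using N(3)[OF Nk] .
    have len: "t - jump_time Q x \<omega> k \<le> fst (\<omega> !! k) / - Q (jump_chain x \<omega> k) (jump_chain x \<omega> k)"
      using k(2) by (simp add: jump_time_def)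
    have "\<bar>time_integral Q x \<omega> f t\<bar> \<le> \<bar>\<Sum>j<k. F j\<bar> + \<bar>(t - jump_time Q x \<omega> k) * f (jump_chain x \<omega> k)\<bar>"
      unfolding time_integral_eq[OF k] F_def times_divide_eq_left times_divide_eq_right by (rule abs_triangle_ineq)
    also have "\<bar>(t - jump_time Q x \<omega> k) * f (jump_chain x \<omega> k)\<bar> \<le>
        \<bar>fst (\<omega> !! k) / - Q (jump_chain x \<omega> k) (jump_chain x \<omega> k)\<bar> * \<bar>f (jump_chain x \<omega> k)\<bar>"
    proof -
      have "\<bar>t - jump_time Q x \<omega> k\<bar> \<le> \<bar>fst (\<omega> !! k) / - Q (jump_chain x \<omega> k) (jump_chain x \<omega> k)\<bar>"
        using order_trans[OF len abs_ge_self] k(1) by (simp only: abs_of_nonneg diff_ge_0_iff_ge)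
      then show ?thesis unfolding abs_mult by (rule mult_right_mono) simp
    qed
    also have "\<dots> = \<bar>F k\<bar>" by (simp add: F_def abs_mult)
    also have "\<bar>\<Sum>j<k. F j\<bar> + \<bar>F k\<bar> \<le> \<delta> * real k"
      using N(1)[OF Nk] kpos by (simp add: field_simps)
    also have "\<dots> \<le> \<delta> * (2 * hi * t)"
    proof -
      have "real k / (2 * hi) \<le> t" using N(2)[OF Nk] k by simp
      then show ?thesis using \<open>0 < \<delta>\<close> hi_pos by (intro mult_left_mono) (auto simp: field_simps)
    qed
    also have "\<dots> = \<epsilon> / 2 * t" using hi_pos by (simp add: \<delta>_def field_simps)
    finally have "\<bar>time_integral Q x \<omega> f t\<bar> / t \<le> \<epsilon> / 2" using elim by (simp add: field_simps)
    then have "\<bar>time_integral Q x \<omega> f t\<bar> / t < \<epsilon>" using \<open>0 < \<epsilon>\<close> by linarith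
    then show ?case using elim by (simp add: dist_real_def)
  qed
qed

end

end

section \<open>The distribution of a single step\<close>

abbreviation exponential_measure :: "real measure" where
  "exponential_measure \<equiv> density lborel (exponential_density 1)"

interpretation exponential: prob_space exponential_measure
  by (rule prob_space_exponential_density) simp

lemma exponential_moment: "has_bochner_integral exponential_measure (\<lambda>e. e ^ i) (fact i)"
proof -
  have "distributed exponential_measure lborel (\<lambda>x. x) (exponential_density 1)"
    by (auto simp: distributed_def intro!: distr_id2)
  from exponential.has_bochner_integral_erlang_ith_moment[OF _ this] show ?thesis by simp
qed

lemma exponential_AE_pos: "AE e in exponential_measure. 0 < e"
  using AE_lborel_singleton[of 0]
  by (subst AE_density) (auto simp: erlang_density_def elim!: eventually_mono)

lemma has_bochner_integral_of_distr:
  fixes f :: "'b \<Rightarrow> real"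
  assumes "g \<in> M \<rightarrow>\<^sub>M N" and "has_bochner_integral (distr M N g) f I"
  shows "has_bochner_integral M (\<lambda>x. f (g x)) I"
  using assms borel_measurable_has_bochner_integral[OF assms(2)]
  by (auto simp: has_bochner_integral_iff integral_distr integrable_distr_eq)

text \<open>The distribution of one step: a standard exponential variable and an independent random map.\<close>

definition step_measure :: "(state \<Rightarrow> state \<Rightarrow> real) \<Rightarrow> (real \<times> (state \<Rightarrow> state)) measure" where
  "step_measure Q = exponential_measure \<Otimes>\<^sub>M PiM UNIV (\<lambda>x. measure_pmf (jump_pmf Q x))"

lemma path_measure_eq: "path_measure Q = stream_space (step_measure Q)"
  by (simp add: path_measure_def step_measure_def)

context
  fixes Q :: "state \<Rightarrow> state \<Rightarrow> real"
begin

interpretation J: prob_space "PiM UNIV (\<lambda>x. measure_pmf (jump_pmf Q x))"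
  by (intro prob_space_PiM) (rule prob_space_measure_pmf)

interpretation P: pair_prob_space exponential_measure "PiM UNIV (\<lambda>x. measure_pmf (jump_pmf Q x))" ..

lemma prob_space_step_measure: "prob_space (step_measure Q)"
  unfolding step_measure_def by (rule P.prob_space_axioms)

lemma measurable_step_fst[measurable]: "fst \<in> borel_measurable (step_measure Q)"
  unfolding step_measure_def by (simp add: measurable_fst'')

lemma measurable_step_snd[measurable]: "(\<lambda>a. snd a x) \<in> step_measure Q \<rightarrow>\<^sub>M count_space UNIV"
proof -
  have "(\<lambda>a. snd a x) \<in> step_measure Q \<rightarrow>\<^sub>M measure_pmf (jump_pmf Q x)"
    unfolding step_measure_def
    by (rule measurable_compose[OF measurable_snd measurable_component_singleton]) simp
  then show ?thesis by (simp cong: measurable_cong_sets)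
qed

lemma distr_step_fst: "distr (step_measure Q) exponential_measure fst = exponential_measure"
  unfolding step_measure_def by (rule J.distr_pair_fst)

lemma distr_step_snd: "distr (step_measure Q) (jump_pmf Q x) (\<lambda>a. snd a x) = jump_pmf Q x"
proof -
  let ?J = "PiM UNIV (\<lambda>x. measure_pmf (jump_pmf Q x))"
  have "distr (step_measure Q) (jump_pmf Q x) (\<lambda>a. snd a x) =
     distr (distr (step_measure Q) ?J snd) (jump_pmf Q x) (\<lambda>F. F x)"
    unfolding step_measure_def by (subst distr_distr) (auto simp: comp_def)
  also have "distr (step_measure Q) ?J snd = ?J"
  proof (rule measure_eqI)
    fix X assume "X \<in> sets (distr (step_measure Q) ?J snd)"
    then have X[measurable]: "X \<in> sets ?J" by simp
    have "emeasure (distr (step_measure Q) ?J snd) X = emeasure (step_measure Q) (space exponential_measure \<times> X)"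
      unfolding step_measure_def using sets.sets_into_space[OF X]
      by (subst emeasure_distr) (auto intro!: arg_cong2[where f = emeasure] simp: space_pair_measure)
    also have "\<dots> = emeasure ?J X"
      using J.emeasure_pair_measure_Times[OF sets.top X, of exponential_measure] exponential.emeasure_space_1
      unfolding step_measure_def by (simp only: mult_1)
    finally show "emeasure (distr (step_measure Q) ?J snd) X = emeasure ?J X" .
  qed simp
  also have "distr ?J (jump_pmf Q x) (\<lambda>F. F x) = jump_pmf Q x"
    by (rule distr_PiM_component) (auto intro: prob_space_measure_pmf)
  finally show ?thesis .
qed

lemma nn_integral_step_snd:
  "(\<integral>\<^sup>+a. f (snd a x) \<partial>step_measure Q) = (\<integral>\<^sup>+y. f y \<partial>jump_pmf Q x)"
proof -
  have "(\<integral>\<^sup>+y. f y \<partial>jump_pmf Q x) = (\<integral>\<^sup>+y. f y \<partial>distr (step_measure Q) (jump_pmf Q x) (\<lambda>a. snd a x))"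
    by (simp only: distr_step_snd)
  also have "\<dots> = (\<integral>\<^sup>+a. f (snd a x) \<partial>step_measure Q)"
    by (rule nn_integral_distr) (auto cong: measurable_cong_sets)
  finally show ?thesis ..
qed

lemma has_bochner_integral_step_snd:
  fixes f :: "state \<Rightarrow> real"
  assumes "integrable (jump_pmf Q x) f"
  shows "has_bochner_integral (step_measure Q) (\<lambda>a. f (snd a x)) (\<integral>y. f y \<partial>jump_pmf Q x)"
proof (rule has_bochner_integral_of_distr[where f = f and g = "\<lambda>a. snd a x" and N = "measure_pmf (jump_pmf Q x)"])
  show "has_bochner_integral (distr (step_measure Q) (jump_pmf Q x) (\<lambda>a. snd a x)) f (\<integral>y. f y \<partial>jump_pmf Q x)"
    unfolding distr_step_snd using assms by (rule has_bochner_integral_integrable)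
qed (auto cong: measurable_cong_sets)

lemma has_bochner_integral_step_fst:
  "has_bochner_integral (step_measure Q) (\<lambda>a. fst a ^ i) (fact i)"
proof (rule has_bochner_integral_of_distr[where f = "\<lambda>e. e ^ i" and g = fst and N = exponential_measure])
  show "has_bochner_integral (distr (step_measure Q) exponential_measure fst) (\<lambda>e. e ^ i) (fact i)"
    unfolding distr_step_fst by (rule exponential_moment)
qed (auto cong: measurable_cong_sets)

lemma AE_step_fst: "AE a in step_measure Q. 0 < fst a"
proof -
  have "AE e in distr (step_measure Q) exponential_measure fst. 0 < e"
    unfolding distr_step_fst by (rule exponential_AE_pos)
  then show ?thesis by (rule AE_distrD[rotated]) (simp cong: measurable_cong_sets)
qed

end

section \<open>The generator and its time averages\<close>

text \<open>The generator of the chain with rate matrix \<open>Q\<close>.\<close>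

definition generator :: "(state \<Rightarrow> state \<Rightarrow> real) \<Rightarrow> (state \<Rightarrow> real) \<Rightarrow> state \<Rightarrow> real" where
  "generator Q u x = (\<Sum>\<^sub>\<infinity>y. Q x y * u y)"

text \<open>Conservative rate matrices with finitely many transitions from each state.\<close>

locale rate_matrix = bounded_exit_rates +
  assumes rate_nonneg: "\<And>x y. x \<noteq> y \<Longrightarrow> 0 \<le> Q x y"
    and finite_range: "\<And>x. finite {y. Q x y \<noteq> 0}"
    and conservative: "\<And>x. Q x x = - (\<Sum>y\<in>{y. Q x y \<noteq> 0} - {x}. Q x y)"
begin

lemma pmf_jump: "pmf (jump_pmf Q x) y = (if y = x then 0 else Q x y / (- Q x x))"
  unfolding jump_pmf_def
proof (rule pmf_embed_pmf)
  fix y show "0 \<le> (if y = x then 0 else Q x y / (- Q x x))"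
    using divide_nonneg_pos[OF rate_nonneg exit_pos, of x y] by simp
next
  let ?F = "{y. Q x y \<noteq> 0} - {x}"
  have "(\<integral>\<^sup>+y. ennreal (if y = x then 0 else Q x y / - Q x x) \<partial>count_space UNIV) =
     (\<Sum>y\<in>?F. ennreal (Q x y / - Q x x))"
    using finite_range[of x]
    by (subst nn_integral_count_space'[of ?F]) (auto intro!: sum.cong split: if_splits)
  also have "\<dots> = ennreal (\<Sum>y\<in>?F. Q x y / - Q x x)"
  proof (rule sum_ennreal)
    fix y assume "y \<in> ?F"
    then show "0 \<le> Q x y / - Q x x"
      by (intro divide_nonneg_nonneg rate_nonneg less_imp_le[OF exit_pos]) auto
  qed
  also have "(\<Sum>y\<in>?F. Q x y / - Q x x) = (\<Sum>y\<in>?F. Q x y) / - Q x x"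
    by (simp only: sum_divide_distrib)
  also have "(\<Sum>y\<in>?F. Q x y) = - Q x x" using conservative[of x] by linarith
  finally show "(\<integral>\<^sup>+y. ennreal (if y = x then 0 else Q x y / - Q x x) \<partial>count_space UNIV) = 1"
    using exit_pos[of x] by simp
qed

lemma finite_set_pmf_jump: "finite (set_pmf (jump_pmf Q x))"
  by (rule finite_subset[OF _ finite_range[of x]]) (auto simp: set_pmf_eq pmf_jump)

lemma integrable_jump [simp]: "integrable (jump_pmf Q x) (f :: state \<Rightarrow> real)"
  by (rule integrable_measure_pmf_finite[OF finite_set_pmf_jump])

lemma generator_eq: "generator Q u x = - Q x x * (measure_pmf.expectation (jump_pmf Q x) u - u x)"
proof -
  let ?G = "{y. Q x y \<noteq> 0}"
  have x: "x \<in> ?G" using exit_pos[of x] by auto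
  have "generator Q u x = (\<Sum>\<^sub>\<infinity>y\<in>?G. Q x y * u y)"
    unfolding generator_def by (rule infsum_cong_neutral) auto
  also have "\<dots> = (\<Sum>y\<in>?G. Q x y * u y)" using finite_range by simp
  also have "\<dots> = Q x x * u x + (\<Sum>y\<in>?G - {x}. Q x y * u y)"
    using finite_range x by (rule sum.remove)
  also have "(\<Sum>y\<in>?G - {x}. Q x y * u y) = - Q x x * (\<Sum>y\<in>?G - {x}. u y * (Q x y / - Q x x))"
    unfolding sum_distrib_left using exit_pos[of x] by (intro sum.cong) (auto simp: field_simps)
  also have "(\<Sum>y\<in>?G - {x}. u y * (Q x y / - Q x x)) = (\<Sum>y\<in>?G - {x}. u y * pmf (jump_pmf Q x) y)"
    by (intro sum.cong) (auto simp: pmf_jump)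
  also have "\<dots> = measure_pmf.expectation (jump_pmf Q x) u"
    using finite_range
    by (subst integral_measure_pmf_real[where A = "?G - {x}"]) (auto simp: set_pmf_eq pmf_jump split: if_splits)
  finally show ?thesis by (simp add: algebra_simps)
qed

end

text \<open>\<open>W\<close> is the weight that bounds the test functions, and \<open>V\<close> is a Lyapunov function that dominates
  \<open>W\<^sup>2\<close> and hence keeps the second moments of the test functions bounded along the jump chain.\<close>

locale lyapunov_chain = rate_matrix +
  fixes W V :: "state \<Rightarrow> real" and C c b M :: real
  assumes W_ge_1: "\<And>x. 1 \<le> W x" and generator_W: "\<And>x. generator Q W x \<le> C * W x"
    and V_ge_1: "\<And>x. 1 \<le> V x" and generator_V: "\<And>x. generator Q V x \<le> - c * V x + b"
    and W_V: "\<And>x. (W x)\<^sup>2 \<le> M * V x" and pos: "0 \<le> C" "0 < c" "0 \<le> b" "0 < M"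
begin

text \<open>The generator inequality for \<open>V\<close>, divided by the exit rate.  The constant \<open>hi + c\<close> instead of
  \<open>hi\<close> makes the contraction factor positive.\<close>

lemma expectation_V: "measure_pmf.expectation (jump_pmf Q x) V \<le> (1 - c / (hi + c)) * V x + b / lo"
proof -
  have "- Q x x * (measure_pmf.expectation (jump_pmf Q x) V - V x) \<le> - c * V x + b"
    using generator_V[of x] by (simp only: generator_eq)
  then have "measure_pmf.expectation (jump_pmf Q x) V - V x \<le> (- c * V x + b) / - Q x x"
    using exit_pos[of x] by (simp add: field_simps)
  also have "\<dots> = - (c * V x / - Q x x) + b / - Q x x" using exit_pos[of x] by (simp add: field_simps)
  also have "\<dots> \<le> - (c * V x / (hi + c)) + b / lo"
    using exit_pos[of x] exit_rate[of x] lo pos V_ge_1[of x] hi_pos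
    by (intro add_mono le_imp_neg_le divide_left_mono mult_pos_pos mult_nonneg_nonneg) auto
  finally show ?thesis by (simp add: algebra_simps)
qed

sublocale stream_walk "step_measure Q" V "1 - c / (hi + c)" "b / lo"
proof (intro stream_walk.intro stream_walk_axioms.intro)
  show "prob_space (step_measure Q)" by (rule prob_space_step_measure)
  show "(\<integral>\<^sup>+a. ennreal (V (snd a x)) \<partial>step_measure Q) \<le> ennreal ((1 - c / (hi + c)) * V x + b / lo)" for x
  proof -
    have "(\<integral>\<^sup>+a. ennreal (V (snd a x)) \<partial>step_measure Q) = (\<integral>\<^sup>+y. ennreal (V y) \<partial>jump_pmf Q x)"
      by (rule nn_integral_step_snd)
    also have "\<dots> = ennreal (measure_pmf.expectation (jump_pmf Q x) V)"
      using order_trans[OF zero_le_one V_ge_1]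
      by (intro nn_integral_eq_integral AE_I2) (simp_all only: integrable_jump)
    finally show ?thesis using expectation_V[of x] by (simp add: ennreal_leI)
  qed
qed (use V_ge_1 pos lo hi_pos in \<open>auto simp: field_simps\<close>)

lemma AE_regular_event: "AE \<omega> in path_measure Q. regular_event \<omega>"
proof -
  have "AE \<omega> in path_measure Q. stream_all (\<lambda>a. 0 < fst a) \<omega>"
    unfolding path_measure_eq by (rule AE_stream_all) (simp_all add: AE_step_fst)
  \<comment> \<open>The summands do not depend on the state, so the initial state is irrelevant.\<close>
  moreover have "AE \<omega> in path_measure Q. (\<lambda>n. path_sum (\<lambda>y a. fst a - 1) undefined \<omega> n / real n) \<longlonglongrightarrow> 0"
    unfolding path_measure_eq
  proof (rule AE_path_sum_tendsto)
    fix y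
    have 1: "has_bochner_integral (step_measure Q) (\<lambda>a. fst a - 1) (1 - 1)"
      using has_bochner_integral_step_fst[of Q 1]
      by (intro has_bochner_integral_diff) (auto simp: has_bochner_integral_iff prob_space)
    then show "(\<integral>a. fst a - 1 \<partial>step_measure Q) = 0" by (simp add: has_bochner_integral_iff)
    have 2: "has_bochner_integral (step_measure Q) (\<lambda>a. fst a ^ 2 - 2 * fst a ^ 1 + 1) (2 - 2 * 1 + 1)"
      using has_bochner_integral_step_fst[of Q 1] has_bochner_integral_step_fst[of Q 2]
      by (intro has_bochner_integral_diff has_bochner_integral_add has_bochner_integral_mult_right)
         (auto simp: has_bochner_integral_iff prob_space)
    have "(\<integral>\<^sup>+a. ennreal ((fst a - 1)\<^sup>2) \<partial>step_measure Q) = ennreal 1"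
    proof -
      have "(\<lambda>a. fst a ^ 2 - 2 * fst a ^ 1 + 1) = (\<lambda>a :: real \<times> (state \<Rightarrow> state). (fst a - 1)\<^sup>2)"
        by (simp add: power2_diff fun_eq_iff)
      with 2 show ?thesis
        by (subst nn_integral_eq_integral) (auto simp: has_bochner_integral_iff)
    qed
    then show "(\<integral>\<^sup>+a. ennreal ((fst a - 1)\<^sup>2) \<partial>step_measure Q) \<le> ennreal (1 * V y)"
      using V_ge_1[of y] by (simp add: ennreal_leI)
  qed auto
  ultimately show ?thesis
    by eventually_elim (auto simp: regular_event_def stream_all_def path_sum_def)
qed

lemma abs_expectation_le:
  assumes u: "\<And>x. \<bar>u x\<bar> \<le> K * W x" and K: "0 \<le> K"
  shows "\<bar>measure_pmf.expectation (jump_pmf Q x) u\<bar> \<le> K * (1 + C / lo) * W x"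
proof -
  have "\<bar>measure_pmf.expectation (jump_pmf Q x) u\<bar> \<le> measure_pmf.expectation (jump_pmf Q x) (\<lambda>y. \<bar>u y\<bar>)"
    by (rule integral_abs_bound)
  also have "\<dots> \<le> measure_pmf.expectation (jump_pmf Q x) (\<lambda>y. K * W y)"
    by (intro integral_mono u) auto
  also have "\<dots> = K * measure_pmf.expectation (jump_pmf Q x) W" by simp
  also have "measure_pmf.expectation (jump_pmf Q x) W \<le> (1 + C / lo) * W x"
  proof -
    have "- Q x x * (measure_pmf.expectation (jump_pmf Q x) W - W x) \<le> C * W x"
      using generator_W[of x] by (simp only: generator_eq)
    then have "measure_pmf.expectation (jump_pmf Q x) W - W x \<le> (C * W x) / - Q x x"
      using exit_pos[of x] by (simp add: field_simps)
    also have "\<dots> \<le> C * W x / lo"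
      using exit_pos[of x] exit_rate[of x] lo pos W_ge_1[of x]
      by (intro divide_left_mono mult_pos_pos mult_nonneg_nonneg) auto
    finally show ?thesis by (simp add: algebra_simps)
  qed
  finally show ?thesis using K by (simp add: mult_left_mono mult.assoc)
qed

lemma square_bound:
  assumes u: "\<And>x. \<bar>u x\<bar> \<le> K * W x" and K: "0 \<le> K"
  shows "(u x)\<^sup>2 \<le> K\<^sup>2 * M * V x"
proof -
  have "(u x)\<^sup>2 \<le> (K * W x)\<^sup>2" using u[of x] K by (intro abs_le_square_iff[THEN iffD1]) auto
  also have "\<dots> = K\<^sup>2 * (W x)\<^sup>2" by (simp add: power_mult_distrib)
  also have "\<dots> \<le> K\<^sup>2 * (M * V x)" by (intro mult_left_mono W_V) simp
  finally show ?thesis by (simp add: mult.assoc)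
qed

text \<open>The analytic core of the argument.  With \<open>w y = P u y - u y\<close>, where \<open>P\<close> is the transition
  operator of the jump chain, the integral of \<open>generator Q u\<close> over the \<open>k\<close>-th holding period is
  \<open>e\<^sub>k * w (X\<^sub>k)\<close>.  The differences \<open>u (X\<^sub>k\<^sub>+\<^sub>1) - u (X\<^sub>k) - e\<^sub>k * w (X\<^sub>k)\<close> are centred given the past
  and have bounded second moments, so their averages vanish; and \<open>u (X\<^sub>n) / n\<close> vanishes because the
  second moments of \<open>u (X\<^sub>n)\<close> are bounded.\<close>

theorem time_average_generator:
  assumes u: "\<And>x. \<bar>u x\<bar> \<le> K * W x" and K: "0 \<le> K"
  shows "AE \<omega> in path_measure Q. ((\<lambda>t. time_integral Q x \<omega> (generator Q u) t / t) \<longlongrightarrow> 0) at_top"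
proof -
  define E where "E y = measure_pmf.expectation (jump_pmf Q y) u" for y
  define w where "w y = E y - u y" for y
  define L where "L = K * (1 + C / lo) + K"
  have L: "0 \<le> L" using K pos lo by (simp add: L_def)
  have w_bound: "\<bar>w y\<bar> \<le> L * W y" for y
    using abs_expectation_le[OF u K, of y] u[of y] unfolding w_def E_def L_def
    by (simp add: algebra_simps abs_le_iff)
  have gen: "generator Q u y / - Q y y = w y" for y
    using exit_pos[of y] by (simp add: generator_eq w_def E_def)
  have e2: "(\<integral>\<^sup>+a. ennreal ((fst a * k)\<^sup>2) \<partial>step_measure Q) = ennreal (2 * k\<^sup>2)" for k
  proof -
    have "has_bochner_integral (step_measure Q) (\<lambda>a. fst a ^ 2 * k\<^sup>2) (2 * k\<^sup>2)"
      using has_bochner_integral_step_fst[of Q 2] by (intro has_bochner_integral_mult_left) simp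
    then show ?thesis
      by (subst nn_integral_eq_integral) (auto simp: has_bochner_integral_iff power_mult_distrib)
  qed
  define \<phi> where "\<phi> y a = u (snd a y) - u y - fst a * w y" for y and a :: "real \<times> (state \<Rightarrow> state)"
  define B where "B = 3 * (K\<^sup>2 * M) * (1 + b / lo) + 3 * (K\<^sup>2 * M) + 6 * (L\<^sup>2 * M)"
  \<comment> \<open>The square of a sum of three terms is at most three times the sum of their squares;
    \<open>6\<close> is \<open>3\<close> times the second moment of a standard exponential variable.\<close>
  have "AE \<omega> in paths. (\<lambda>n. path_sum \<phi> x \<omega> n / real n) \<longlonglongrightarrow> 0"
  proof (rule AE_path_sum_tendsto)
    show "\<phi> y \<in> borel_measurable (step_measure Q)" for y
      unfolding \<phi>_def by measurable
    show "0 \<le> B" using pos lo by (simp add: B_def)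
    show "(\<integral>a. \<phi> y a \<partial>step_measure Q) = 0" for y
    proof -
      have "has_bochner_integral (step_measure Q) (\<phi> y) (E y - u y - fact 1 * w y)"
        unfolding \<phi>_def E_def using has_bochner_integral_step_fst[of Q 1]
        by (intro has_bochner_integral_diff has_bochner_integral_step_snd has_bochner_integral_mult_left)
           (auto simp: has_bochner_integral_iff prob_space)
      then show ?thesis by (simp add: has_bochner_integral_iff w_def)
    qed
    show "(\<integral>\<^sup>+a. ennreal ((\<phi> y a)\<^sup>2) \<partial>step_measure Q) \<le> ennreal (B * V y)" for y
    proof -
      have sq: "(p - q - r)\<^sup>2 \<le> 3 * p\<^sup>2 + (3 * q\<^sup>2 + 3 * r\<^sup>2)" for p q r :: real
        using zero_le_power2[of "p + q"] zero_le_power2[of "p + r"] zero_le_power2[of "q - r"]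
        by (simp add: power2_eq_square algebra_simps)
      have "(\<integral>\<^sup>+a. ennreal ((\<phi> y a)\<^sup>2) \<partial>step_measure Q) \<le>
        (\<integral>\<^sup>+a. ennreal (3 * (u (snd a y))\<^sup>2) + (ennreal (3 * (u y)\<^sup>2) + ennreal 3 * ennreal ((fst a * w y)\<^sup>2)) \<partial>step_measure Q)"
        unfolding \<phi>_def
        by (intro nn_integral_mono order_trans[OF ennreal_leI[OF sq]]) (simp add: ennreal_mult)
      also have "\<dots> = (\<integral>\<^sup>+a. ennreal (3 * (u (snd a y))\<^sup>2) \<partial>step_measure Q) + (ennreal (3 * (u y)\<^sup>2) + ennreal 3 * ennreal (2 * (w y)\<^sup>2))"
        by (simp add: nn_integral_add nn_integral_cmult emeasure_space_1 e2)
      also have "(\<integral>\<^sup>+a. ennreal (3 * (u (snd a y))\<^sup>2) \<partial>step_measure Q) = (\<integral>\<^sup>+z. ennreal (3 * (u z)\<^sup>2) \<partial>jump_pmf Q y)"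
        by (rule nn_integral_step_snd)
      also have "\<dots> = ennreal (measure_pmf.expectation (jump_pmf Q y) (\<lambda>z. 3 * (u z)\<^sup>2))"
        by (rule nn_integral_eq_integral) auto
      also have "\<dots> + (ennreal (3 * (u y)\<^sup>2) + ennreal 3 * ennreal (2 * (w y)\<^sup>2)) =
         ennreal (measure_pmf.expectation (jump_pmf Q y) (\<lambda>z. 3 * (u z)\<^sup>2) + (3 * (u y)\<^sup>2 + 3 * (2 * (w y)\<^sup>2)))"
        by (simp add: ennreal_mult)
      also have "\<dots> \<le> ennreal (B * V y)"
      proof (rule ennreal_leI)
        have "measure_pmf.expectation (jump_pmf Q y) (\<lambda>z. 3 * (u z)\<^sup>2) \<le>
           measure_pmf.expectation (jump_pmf Q y) (\<lambda>z. 3 * (K\<^sup>2 * M * V z))"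
          by (intro integral_mono mult_left_mono square_bound u K) auto
        also have "\<dots> = 3 * (K\<^sup>2 * M) * measure_pmf.expectation (jump_pmf Q y) V" by (simp add: mult.assoc)
        also have "\<dots> \<le> 3 * (K\<^sup>2 * M) * ((1 + b / lo) * V y)"
        proof (intro mult_left_mono)
          have "(1 - c / (hi + c)) * V y \<le> 1 * V y" "b / lo * 1 \<le> b / lo * V y"
            using pos hi_pos lo V_ge_1[of y]
            by (intro mult_right_mono mult_left_mono; simp)+
          then show "measure_pmf.expectation (jump_pmf Q y) V \<le> (1 + b / lo) * V y"
            using expectation_V[of y] by (simp add: algebra_simps)
        qed (use pos in simp)
        finally have "measure_pmf.expectation (jump_pmf Q y) (\<lambda>z. 3 * (u z)\<^sup>2) \<le> 3 * (K\<^sup>2 * M) * (1 + b / lo) * V y"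
          by (simp add: mult.assoc)
        moreover have "3 * (u y)\<^sup>2 \<le> 3 * (K\<^sup>2 * M) * V y" using square_bound[OF u K, of y] by simp
        moreover have "3 * (2 * (w y)\<^sup>2) \<le> 6 * (L\<^sup>2 * M) * V y" using square_bound[OF w_bound L, of y] by simp
        ultimately show "measure_pmf.expectation (jump_pmf Q y) (\<lambda>z. 3 * (u z)\<^sup>2) + (3 * (u y)\<^sup>2 + 3 * (2 * (w y)\<^sup>2)) \<le> B * V y"
          unfolding B_def distrib_right by linarith
      qed
      finally show ?thesis .
    qed
  qed
  moreover have "AE \<omega> in paths. (\<lambda>n. u (jump_chain x \<omega> n) / real n) \<longlonglongrightarrow> 0"
  proof (rule AE_at_step_tendsto[where \<phi> = "\<lambda>y a. u y" and K = "K\<^sup>2 * M"])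
    show "(\<integral>\<^sup>+a. ennreal ((u y)\<^sup>2) \<partial>step_measure Q) \<le> ennreal (K\<^sup>2 * M * V y)" for y
      using square_bound[OF u K, of y] by (simp add: emeasure_space_1 ennreal_leI)
  qed (use pos in auto)
  moreover have "AE \<omega> in paths. (\<lambda>n. fst (\<omega> !! n) * w (jump_chain x \<omega> n) / real n) \<longlonglongrightarrow> 0"
  proof (rule AE_at_step_tendsto[where \<phi> = "\<lambda>y a. fst a * w y" and K = "2 * (L\<^sup>2 * M)"])
    show "(\<integral>\<^sup>+a. ennreal ((fst a * w y)\<^sup>2) \<partial>step_measure Q) \<le> ennreal (2 * (L\<^sup>2 * M) * V y)" for y
      unfolding e2 using square_bound[OF w_bound L, of y] by (simp add: ennreal_leI)
  qed (use pos in auto)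
  moreover note AE_regular_event[unfolded path_measure_eq]
  ultimately have "AE \<omega> in paths. ((\<lambda>t. time_integral Q x \<omega> (generator Q u) t / t) \<longlongrightarrow> 0) at_top"
  proof eventually_elim
    case (elim \<omega>)
    show ?case
    proof (rule time_average_tendsto_zero[OF elim(4)], unfold gen)
      show "(\<lambda>n. fst (\<omega> !! n) * w (jump_chain x \<omega> n) / real n) \<longlonglongrightarrow> 0" by (rule elim(3))
      have tele: "path_sum \<phi> x \<omega> n = u (jump_chain x \<omega> n) - u x - (\<Sum>j<n. fst (\<omega> !! j) * w (jump_chain x \<omega> j))" for n
        by (induction n) (auto simp: path_sum_def \<phi>_def)
      have "(\<lambda>n. u (jump_chain x \<omega> n) / real n - u x / real n - path_sum \<phi> x \<omega> n / real n) \<longlonglongrightarrow> 0 - 0 - 0"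
        by (intro tendsto_diff elim lim_const_over_n)
      then show "(\<lambda>n. (\<Sum>j<n. fst (\<omega> !! j) * w (jump_chain x \<omega> j)) / real n) \<longlonglongrightarrow> 0"
        unfolding tele by (simp flip: diff_divide_distrib)
    qed
  qed
  then show ?thesis by (simp only: path_measure_eq)
qed

end

section \<open>Occupation of states and bounds on pathwise costs\<close>

context lyapunov_chain
begin

lemma weighted_space_boundD:
  assumes "u \<in> weighted_space W"
  obtains K where "0 \<le> K" "\<And>x. \<bar>u x\<bar> \<le> K * W x"
proof -
  obtain K where K: "\<And>x. \<bar>u x\<bar> / W x \<le> K"
    using assms by (auto simp: weighted_space_def bdd_above_def)
  show ?thesis
  proof
    show "0 \<le> max K 0" by simp
    fix x
    have "\<bar>u x\<bar> \<le> K * W x" using K[of x] W_ge_1[of x] by (simp add: field_simps)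
    also have "\<dots> \<le> max K 0 * W x" using W_ge_1[of x] by (intro mult_right_mono) auto
    finally show "\<bar>u x\<bar> \<le> max K 0 * W x" .
  qed
qed

lemma AE_time_average_generator:
  assumes "u \<in> weighted_space W"
  shows "AE \<omega> in path_measure Q. regular_event \<omega> \<and>
    ((\<lambda>t. time_integral Q x \<omega> (generator Q u) t / t) \<longlongrightarrow> 0) at_top"
proof -
  obtain K where K: "0 \<le> K" "\<And>x. \<bar>u x\<bar> \<le> K * W x"
    using weighted_space_boundD[OF assms] by blast
  show ?thesis using time_average_generator[OF K(2,1), of x] AE_regular_event by eventually_elim simp
qed

text \<open>Started in \<open>x\<close>, the chain almost surely spends a positive fraction of time in \<open>z\<close>; the lower
  bound \<open>\<kappa>\<close> may depend on the path.\<close>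

definition occupied :: "state \<Rightarrow> state \<Rightarrow> bool" where
  "occupied x z \<longleftrightarrow> (AE \<omega> in path_measure Q. \<exists>\<kappa>>0.
     \<forall>\<^sub>F t in at_top. \<kappa> \<le> time_integral Q x \<omega> (\<lambda>y. of_bool (y = z)) t / t)"

lemma W_in_weighted_space: "W \<in> weighted_space W"
proof -
  have "\<bar>W y\<bar> / W y \<le> 1" for y using W_ge_1[of y] by simp
  then show ?thesis by (auto simp: weighted_space_def intro!: bdd_aboveI[of _ 1])
qed

text \<open>Averaging the drift inequality along the path and letting time tend to infinity gives
  \<open>0 \<le> - d + e * (fraction of time in z)\<close>.\<close>

lemma occupied_atom:
  assumes drift: "\<And>y. generator Q W y \<le> - d * W y + e * of_bool (y = z)" and d: "0 < d" "0 \<le> e"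
  shows "occupied x z"
  unfolding occupied_def using AE_time_average_generator[OF W_in_weighted_space, of x]
proof eventually_elim
  case (elim \<omega>)
  then have \<omega>: "regular_event \<omega>" by simp
  let ?o = "time_integral Q x \<omega> (\<lambda>y. of_bool (y = z))"
  have "\<forall>\<^sub>F t in at_top. - (d / 2) < time_integral Q x \<omega> (generator Q W) t / t"
    using elim d by (intro order_tendstoD(1)) auto
  then have "\<forall>\<^sub>F t in at_top. d / (2 * (e + 1)) \<le> ?o t / t"
    using eventually_gt_at_top[of 0]
  proof eventually_elim
    case (elim t)
    have "time_integral Q x \<omega> (generator Q W) t \<le> time_integral Q x \<omega> (\<lambda>y. - d + (e + 1) * of_bool (y = z)) t"
    proof (rule time_integral_mono[OF \<omega>])
      fix y
      have "- d * W y \<le> - d * 1" using W_ge_1[of y] d by (intro mult_left_mono_neg) auto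
      moreover have "e * of_bool (y = z) \<le> (e + 1) * (of_bool (y = z) :: real)" by simp
      ultimately show "generator Q W y \<le> - d + (e + 1) * of_bool (y = z)" using drift[of y] by linarith
    qed (use elim in simp)
    also have "\<dots> = - d * t + (e + 1) * ?o t"
      using elim by (simp only: time_integral_add[OF \<omega>] time_integral_cmult time_integral_const[OF \<omega>] less_imp_le)
    finally have "time_integral Q x \<omega> (generator Q W) t / t \<le> - d + (e + 1) * (?o t / t)"
      using elim(2) by (simp add: field_simps)
    with elim(1) have "d / 2 \<le> (e + 1) * (?o t / t)" by linarith
    then show ?case using d by (simp add: field_simps)
  qed
  moreover have "0 < d / (2 * (e + 1))" using d by simp
  ultimately show ?case by blast
qed

lemma generator_of_bool: "generator Q (\<lambda>y. of_bool (y = z)) x = Q x z"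
proof -
  have "generator Q (\<lambda>y. of_bool (y = z)) x = (\<Sum>\<^sub>\<infinity>y\<in>{z}. Q x y)"
    unfolding generator_def by (rule infsum_cong_neutral) auto
  then show ?thesis by simp
qed

text \<open>The generator applied to the indicator of \<open>z\<close> is at least \<open>Q y z\<close> at \<open>y\<close>, at least \<open>- hi\<close> at \<open>z\<close>, and
  nonnegative elsewhere; its time average vanishes, so time spent in \<open>y\<close> forces time spent in \<open>z\<close>.\<close>

lemma occupied_step:
  assumes y: "occupied x y" and yz: "0 < Q y z"
  shows "occupied x z"
proof -
  have "\<bar>of_bool (y = z)\<bar> / W y \<le> 1" for y using W_ge_1[of y] by (cases "y = z") auto
  then have "(\<lambda>y. of_bool (y = z)) \<in> weighted_space W"
    by (auto simp only: weighted_space_def intro!: bdd_aboveI[of _ 1])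
  from AE_time_average_generator[OF this, of x] y[unfolded occupied_def]
  show ?thesis unfolding occupied_def
  proof eventually_elim
    case (elim \<omega>)
    then have \<omega>: "regular_event \<omega>" by simp
    let ?o = "\<lambda>z. time_integral Q x \<omega> (\<lambda>y. of_bool (y = z))"
    let ?g = "time_integral Q x \<omega> (generator Q (\<lambda>y. of_bool (y = z)))"
    obtain \<kappa> where \<kappa>: "0 < \<kappa>" "\<forall>\<^sub>F t in at_top. \<kappa> \<le> ?o y t / t" using elim(2) by blast
    have "\<forall>\<^sub>F t in at_top. ?g t / t < Q y z * \<kappa> / 2"
      using elim \<kappa> yz by (intro order_tendstoD(2)) auto
    with \<kappa>(2) have "\<forall>\<^sub>F t in at_top. Q y z * \<kappa> / (2 * hi) \<le> ?o z t / t"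
      using eventually_gt_at_top[of 0]
    proof eventually_elim
      case (elim t)
      have "Q y z * ?o y t = time_integral Q x \<omega> (\<lambda>w. Q y z * of_bool (w = y)) t"
        by (simp only: time_integral_cmult)
      also have "\<dots> \<le> time_integral Q x \<omega> (\<lambda>w. generator Q (\<lambda>y. of_bool (y = z)) w + hi * of_bool (w = z)) t"
      proof (rule time_integral_mono[OF \<omega>])
        fix w
        show "Q y z * of_bool (w = y) \<le> generator Q (\<lambda>y. of_bool (y = z)) w + hi * of_bool (w = z)"
          using exit_rate(2)[of z] rate_nonneg[of w z] yz exit_pos[of z]
          by (cases "w = z"; cases "w = y") (auto simp: generator_of_bool)
      qed (use elim in simp)
      also have "\<dots> = ?g t + hi * ?o z t"
        using elim by (simp only: time_integral_add[OF \<omega>] time_integral_cmult less_imp_le)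
      finally have "Q y z * (?o y t / t) \<le> ?g t / t + hi * (?o z t / t)"
        using elim(3) by (simp add: field_simps)
      moreover have "Q y z * \<kappa> \<le> Q y z * (?o y t / t)" using elim(1) yz by (intro mult_left_mono) auto
      ultimately have "Q y z * \<kappa> / 2 \<le> hi * (?o z t / t)" using elim(2) by linarith
      then show ?case using hi_pos elim(3) by (simp add: field_simps)
    qed
    moreover have "0 < Q y z * \<kappa> / (2 * hi)" using \<kappa> yz hi_pos by simp
    ultimately show ?case by blast
  qed
qed

end

lemma drift_policy: "drift q u (\<beta> x) x = generator (policy_rate q \<beta>) u x"
  by (simp add: drift_def generator_def policy_rate_def)

text \<open>The chain under a fixed policy \<open>\<beta>\<close>, with cost rate \<open>r\<close>.\<close>

locale policy_chain =
  fixes q :: "real \<Rightarrow> state \<Rightarrow> state \<Rightarrow> real" and r :: "state \<Rightarrow> real \<Rightarrow> real" and \<beta> :: "state \<Rightarrow> real"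
    and lo hi and W V :: "state \<Rightarrow> real" and C c b M :: real
  assumes lyapunov: "lyapunov_chain (policy_rate q \<beta>) lo hi W V C c b M"
begin

sublocale lyapunov_chain "policy_rate q \<beta>" lo hi W V C c b M by (rule lyapunov)

lemma pathwise_cost_eq:
  assumes \<omega>: "regular_event \<omega>"
  shows "pathwise_cost q r \<beta> x \<omega> =
    Limsup at_top (\<lambda>t. ereal (time_integral (policy_rate q \<beta>) x \<omega> (\<lambda>y. r y (\<beta> y)) t / t))"
  unfolding pathwise_cost_def Let_def
proof (rule Limsup_eq)
  show "\<forall>\<^sub>F t in at_top. ereal (1 / t * (LBINT s:{0..t}. r (chain (policy_rate q \<beta>) x \<omega> s)
           (\<beta> (Lim (at_left s) (chain (policy_rate q \<beta>) x \<omega>))))) =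
       ereal (time_integral (policy_rate q \<beta>) x \<omega> (\<lambda>y. r y (\<beta> y)) t / t)"
    using eventually_ge_at_top[of 0]
  proof eventually_elim
    case (elim t)
    show ?case
      using path_integral_left_limit[OF \<omega> elim, of "\<lambda>y z. r y (\<beta> z)" x] by simp
  qed
qed

lemma pathwise_cost_le:
  assumes u: "u \<in> weighted_space W" and le: "\<And>y. r y (\<beta> y) + drift q u (\<beta> y) y \<le> g"
  shows "AE \<omega> in path_measure (policy_rate q \<beta>). pathwise_cost q r \<beta> x \<omega> \<le> ereal g"
  using AE_time_average_generator[OF u, of x]
proof eventually_elim
  case (elim \<omega>)
  then have \<omega>: "regular_event \<omega>" by simp
  let ?I = "time_integral (policy_rate q \<beta>) x \<omega>"
  let ?G = "generator (policy_rate q \<beta>) u"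
  have "pathwise_cost q r \<beta> x \<omega> \<le> Limsup at_top (\<lambda>t. ereal (g - ?I ?G t / t))"
    unfolding pathwise_cost_eq[OF \<omega>]
  proof (rule Limsup_mono)
    show "\<forall>\<^sub>F t in at_top. ereal (?I (\<lambda>y. r y (\<beta> y)) t / t) \<le> ereal (g - ?I ?G t / t)"
      using eventually_gt_at_top[of 0]
    proof eventually_elim
      case (elim t)
      have "?I (\<lambda>y. r y (\<beta> y)) t + ?I ?G t = ?I (\<lambda>y. r y (\<beta> y) + ?G y) t"
        using elim by (simp add: time_integral_add[OF \<omega>])
      also have "\<dots> \<le> ?I (\<lambda>y. g) t"
        using elim le by (intro time_integral_mono[OF \<omega>]) (auto simp: drift_policy)
      also have "\<dots> = g * t" using elim by (simp add: time_integral_const[OF \<omega>])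
      finally show ?case using elim by (simp add: field_simps)
    qed
  qed
  also have "Limsup at_top (\<lambda>t. ereal (g - ?I ?G t / t)) = ereal (g - 0)"
    using elim by (intro lim_imp_Limsup tendsto_ereal tendsto_diff tendsto_const) auto
  finally show ?case by simp
qed

text \<open>Slack \<open>d\<close> at an occupied state \<open>z\<close> raises the lower bound for the pathwise cost by \<open>d\<close>
  times a lower bound for the fraction of time spent in \<open>z\<close>.  The case \<open>d = 0\<close> is the plain lower bound.\<close>

lemma pathwise_cost_ge_occupied:
  assumes u: "u \<in> weighted_space W" and d: "0 \<le> d" and z: "occupied x z"
    and ge: "\<And>y. g + d * of_bool (y = z) \<le> r y (\<beta> y) + drift q u (\<beta> y) y"
  shows "AE \<omega> in path_measure (policy_rate q \<beta>). \<exists>\<kappa>>0. ereal (g + d * \<kappa>) \<le> pathwise_cost q r \<beta> x \<omega>"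
  using AE_time_average_generator[OF u, of x] z[unfolded occupied_def]
proof eventually_elim
  case (elim \<omega>)
  then have \<omega>: "regular_event \<omega>" by simp
  let ?I = "time_integral (policy_rate q \<beta>) x \<omega>"
  let ?G = "generator (policy_rate q \<beta>) u"
  obtain \<kappa> where \<kappa>: "0 < \<kappa>" "\<forall>\<^sub>F t in at_top. \<kappa> \<le> ?I (\<lambda>y. of_bool (y = z)) t / t" using elim by blast
  have "ereal (g + d * \<kappa> - 0) = Limsup at_top (\<lambda>t. ereal (g + d * \<kappa> - ?I ?G t / t))"
    using elim by (intro lim_imp_Limsup[symmetric] tendsto_ereal tendsto_diff tendsto_const) auto
  also have "\<dots> \<le> pathwise_cost q r \<beta> x \<omega>"
    unfolding pathwise_cost_eq[OF \<omega>]
  proof (rule Limsup_mono)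
    show "\<forall>\<^sub>F t in at_top. ereal (g + d * \<kappa> - ?I ?G t / t) \<le> ereal (?I (\<lambda>y. r y (\<beta> y)) t / t)"
      using eventually_gt_at_top[of 0] \<kappa>(2)
    proof eventually_elim
      case (elim t)
      have "g * t + d * ?I (\<lambda>y. of_bool (y = z)) t = ?I (\<lambda>y. g + d * of_bool (y = z)) t"
        using elim by (simp only: time_integral_add[OF \<omega>] time_integral_cmult time_integral_const[OF \<omega>] less_imp_le)
      also have "\<dots> \<le> ?I (\<lambda>y. r y (\<beta> y) + ?G y) t"
        using elim ge by (intro time_integral_mono[OF \<omega>]) (auto simp: drift_policy)
      also have "\<dots> = ?I (\<lambda>y. r y (\<beta> y)) t + ?I ?G t"
        using elim by (simp add: time_integral_add[OF \<omega>])
      finally have "(g * t + d * ?I (\<lambda>y. of_bool (y = z)) t) / t \<le> (?I (\<lambda>y. r y (\<beta> y)) t + ?I ?G t) / t"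
        using elim(1) by (intro divide_right_mono) auto
      then have "g + d * (?I (\<lambda>y. of_bool (y = z)) t / t) \<le> ?I (\<lambda>y. r y (\<beta> y)) t / t + ?I ?G t / t"
        using elim(1) by (simp add: add_divide_distrib)
      moreover have "d * \<kappa> \<le> d * (?I (\<lambda>y. of_bool (y = z)) t / t)" using elim d by (intro mult_left_mono)
      ultimately show ?case by simp
    qed
  qed
  finally show ?case using \<kappa> by auto
qed

end

section \<open>The production-inventory chain\<close>

lemma policiesD: "\<beta> \<in> policies A \<Longrightarrow> \<beta> x \<in> A"
  unfolding policies_def by blast

lemma rate_off_diagonal: "y \<noteq> x \<Longrightarrow> rate lam mu a x y = jump_rate lam mu a x y"
  by (simp add: rate_def)

text \<open>The states that can be reached from \<open>x\<close> by a single jump.\<close>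

definition neighbours :: "state \<Rightarrow> state set" where
  "neighbours x = {(fst x, snd x + 1)} \<union> (if 1 \<le> snd x then {(fst x + 1, snd x)} else {}) \<union>
     (if 1 \<le> fst x \<and> 1 \<le> snd x then {(fst x - 1, snd x - 1)} else {})"

lemma finite_neighbours [simp]: "finite (neighbours x)"
  by (simp add: neighbours_def)

lemma not_neighbour_self: "x \<notin> neighbours x"
  by (cases x) (auto simp: neighbours_def)

lemma jump_rate_outside: "y \<notin> neighbours x \<Longrightarrow> jump_rate lam mu a x y = 0"
  by (cases x; cases y) (auto simp: neighbours_def split: if_splits)

lemma sum_neighbours:
  "(\<Sum>y\<in>neighbours (n, i). jump_rate lam mu a (n, i) y * u y) =
     a * u (n, i + 1) + (if 1 \<le> i then lam * u (n + 1, i) else 0) +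
     (if 1 \<le> n \<and> 1 \<le> i then mu * u (n - 1, i - 1) else 0)"
  by (cases n; cases i) (auto simp: neighbours_def)

lemma rate_diagonal:
  "rate lam mu a x x = - (\<Sum>y\<in>neighbours x. jump_rate lam mu a x y)"
proof -
  have "(\<Sum>\<^sub>\<infinity>z\<in>- {x}. jump_rate lam mu a x z) = (\<Sum>\<^sub>\<infinity>z\<in>neighbours x. jump_rate lam mu a x z)"
    by (rule infsum_cong_neutral) (auto simp: jump_rate_outside not_neighbour_self)
  then show ?thesis by (simp add: rate_def)
qed

lemma rate_diagonal_explicit:
  "rate lam mu a (n, i) (n, i) = - (a + (if 1 \<le> i then lam else 0) + (if 1 \<le> n \<and> 1 \<le> i then mu else 0))"
  using sum_neighbours[where u = "\<lambda>_. 1"] by (simp add: rate_diagonal)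

lemma drift_rate:
  "drift (rate lam mu) u a (n, i) = a * (u (n, i + 1) - u (n, i)) +
     (if 1 \<le> i then lam * (u (n + 1, i) - u (n, i)) else 0) +
     (if 1 \<le> n \<and> 1 \<le> i then mu * (u (n - 1, i - 1) - u (n, i)) else 0)"
proof -
  let ?x = "(n, i)"
  have "drift (rate lam mu) u a ?x = (\<Sum>\<^sub>\<infinity>y\<in>insert ?x (neighbours ?x). rate lam mu a ?x y * u y)"
    unfolding drift_def
    by (rule infsum_cong_neutral) (auto simp: rate_off_diagonal jump_rate_outside)
  also have "\<dots> = rate lam mu a ?x ?x * u ?x + (\<Sum>y\<in>neighbours ?x. rate lam mu a ?x y * u y)"
    by (simp add: not_neighbour_self)
  also have "(\<Sum>y\<in>neighbours ?x. rate lam mu a ?x y * u y) = (\<Sum>y\<in>neighbours ?x. jump_rate lam mu a ?x y * u y)"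
    by (intro sum.cong refl arg_cong2[where f = "(*)"] rate_off_diagonal) (metis not_neighbour_self)
  finally show ?thesis
    unfolding sum_neighbours rate_diagonal_explicit
    by (cases "1 \<le> i"; cases "1 \<le> n") (simp_all add: algebra_simps)
qed

lemma INF_affine:
  fixes p s :: real
  assumes "l \<le> h"
  shows "(INF a\<in>{l..h}. p + a * s) = min (p + l * s) (p + h * s)"
proof (rule cInf_eq_minimum)
  show "min (p + l * s) (p + h * s) \<in> (\<lambda>a. p + a * s) ` {l..h}"
    using assms by (auto simp: min_def)
  fix v assume "v \<in> (\<lambda>a. p + a * s) ` {l..h}"
  then obtain a where a: "l \<le> a" "a \<le> h" "v = p + a * s" by auto
  show "min (p + l * s) (p + h * s) \<le> v"
  proof (cases "0 \<le> s")
    case True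
    then have "l * s \<le> a * s" using a by (intro mult_right_mono)
    then show ?thesis using a by simp
  next
    case False
    then have "h * s \<le> a * s" using a by (intro mult_right_mono_neg) auto
    then show ?thesis using a by simp
  qed
qed

lemma abs_min_diff_le:
  fixes p q p' q' e :: real
  assumes "\<bar>p - p'\<bar> \<le> e" "\<bar>q - q'\<bar> \<le> e"
  shows "\<bar>min p q - min p' q'\<bar> \<le> e"
  using assms by (auto simp: min_def abs_le_iff)

text \<open>The control model with the constants of its drift conditions.  \<open>V\<close> is the Lyapunov
  function that dominates \<open>W\<^sup>2\<close>.\<close>

locale inventory =
  fixes lam mu \<gamma> R c0 c1 c2 c3 :: real and S :: nat and W V :: "state \<Rightarrow> real"
    and cW bW MW cV bV MV :: real
  assumes lam: "lam > 0" and mu: "mu > 0" and \<gamma>: "0 < \<gamma>" and \<gamma>_le: "\<gamma> \<le> R"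
    and cost_coeffs: "c0 \<ge> 0" "c1 \<ge> 0" "c2 \<ge> 0" "c3 \<ge> 0"
    and W_ge_1: "\<And>x. 1 \<le> W x" and constants: "0 < cW" "0 \<le> bW" "0 < MW" "0 < cV" "0 \<le> bV" "0 < MV"
    and drift_W: "\<And>x a. a \<in> {\<gamma>..R} \<Longrightarrow> drift (rate lam mu) W a x \<le> - cW * W x + bW * of_bool (x = (0, 0))"
    and cost_le: "\<And>x a. a \<in> {\<gamma>..R} \<Longrightarrow> cost c0 c1 c2 c3 S x a \<le> MW * W x"
    and V_ge_1: "\<And>x. 1 \<le> V x"
    and drift_V: "\<And>x a. a \<in> {\<gamma>..R} \<Longrightarrow> drift (rate lam mu) V a x \<le> - cV * V x + bV"
    and W_V: "\<And>x. (W x)\<^sup>2 \<le> MV * V x"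
begin

abbreviation "q \<equiv> rate lam mu"
abbreviation "r \<equiv> cost c0 c1 c2 c3 S"
abbreviation "A \<equiv> {\<gamma>..R}"

text \<open>A bound for all exit rates, used as the rate of the uniformized chain.\<close>

definition "\<Lambda> = R + lam + mu"

lemma \<Lambda>_pos: "0 < \<Lambda>" using lam mu \<gamma> \<gamma>_le by (simp add: \<Lambda>_def)

lemma endpoints: "\<gamma> \<in> A" "R \<in> A" using \<gamma>_le by auto

lemma cost_nonneg: "a \<in> A \<Longrightarrow> 0 \<le> r x a"
  using \<gamma> cost_coeffs by (cases x) auto

lemma rate_matrix_policy:
  assumes \<beta>: "\<beta> \<in> policies A"
  shows "rate_matrix (policy_rate q \<beta>) \<gamma> \<Lambda>"
proof
  have b: "\<gamma> \<le> \<beta> x" "\<beta> x \<le> R" for x using policiesD[OF \<beta>, of x] by auto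
  show "0 < \<gamma>" by (rule \<gamma>)
  show "\<gamma> \<le> - policy_rate q \<beta> x x" for x
    using b[of x] lam mu by (cases x) (simp add: policy_rate_def rate_diagonal_explicit)
  show "- policy_rate q \<beta> x x \<le> \<Lambda>" for x
    using b[of x] lam mu by (cases x) (simp add: policy_rate_def rate_diagonal_explicit \<Lambda>_def)
  show "0 \<le> policy_rate q \<beta> x y" if "x \<noteq> y" for x y
    using that b[of x] \<gamma> lam mu by (cases x; cases y) (auto simp: policy_rate_def rate_off_diagonal)
  have sub: "{y. policy_rate q \<beta> x y \<noteq> 0} \<subseteq> insert x (neighbours x)" for x
  proof (rule subsetI, rule ccontr)
    fix y assume y: "y \<in> {y. policy_rate q \<beta> x y \<noteq> 0}" "y \<notin> insert x (neighbours x)"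
    then have "policy_rate q \<beta> x y = jump_rate lam mu (\<beta> x) x y"
      unfolding policy_rate_def by (intro rate_off_diagonal) blast
    also have "\<dots> = 0" using y by (intro jump_rate_outside) blast
    finally show False using y by simp
  qed
  then show "finite {y. policy_rate q \<beta> x y \<noteq> 0}" for x
    by (rule finite_subset) simp
  show "policy_rate q \<beta> x x = - (\<Sum>y\<in>{y. policy_rate q \<beta> x y \<noteq> 0} - {x}. policy_rate q \<beta> x y)" for x
  proof -
    have "(\<Sum>y\<in>{y. policy_rate q \<beta> x y \<noteq> 0} - {x}. policy_rate q \<beta> x y) = (\<Sum>y\<in>neighbours x. policy_rate q \<beta> x y)"
      using sub[of x] not_neighbour_self[of x] by (intro sum.mono_neutral_left) auto
    also have "\<dots> = (\<Sum>y\<in>neighbours x. jump_rate lam mu (\<beta> x) x y)"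
      unfolding policy_rate_def by (intro sum.cong refl rate_off_diagonal) (metis not_neighbour_self)
    finally show ?thesis by (simp add: policy_rate_def rate_diagonal)
  qed
qed

lemma policy_chain:
  assumes \<beta>: "\<beta> \<in> policies A"
  shows "policy_chain q \<beta> \<gamma> \<Lambda> W V bW cV bV MV"
proof (intro policy_chain.intro lyapunov_chain.intro lyapunov_chain_axioms.intro)
  note b = policiesD[OF \<beta>]
  show "rate_matrix (policy_rate q \<beta>) \<gamma> \<Lambda>" by (rule rate_matrix_policy[OF \<beta>])
  show "generator (policy_rate q \<beta>) W x \<le> bW * W x" for x
  proof -
    have "0 \<le> cW * W x" using constants W_ge_1[of x] by simp
    moreover have "bW * of_bool (x = (0, 0)) \<le> bW * W x"
      using constants W_ge_1[of x] by (intro mult_left_mono) auto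
    ultimately show ?thesis using drift_W[OF b, of x x] by (simp add: drift_policy[symmetric])
  qed
  show "generator (policy_rate q \<beta>) V x \<le> - cV * V x + bV" for x
    using drift_V[OF b, of x x] by (simp add: drift_policy[symmetric])
qed (use W_ge_1 V_ge_1 W_V constants in auto)

text \<open>The origin is occupied by the drift condition, and every state is reached from it: produce
  the inventory, then let the customers arrive; states without inventory are entered by a service from inventory \<open>1\<close>.\<close>

lemma occupied_all:
  assumes \<beta>: "\<beta> \<in> policies A"
  shows "lyapunov_chain.occupied (policy_rate q \<beta>) x z"
proof -
  interpret policy_chain q r \<beta> \<gamma> \<Lambda> W V bW cV bV MV by (rule policy_chain[OF \<beta>])
  note b = policiesD[OF \<beta>]
  have b_pos: "0 < \<beta> x" for x using b[of x] \<gamma> by auto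
  have "occupied x (0, 0)"
    using drift_W[OF b] constants by (intro occupied_atom) (auto simp: drift_policy[symmetric])
  have up: "occupied x (n, Suc i)" if "occupied x (n, i)" for n i
    using that by (rule occupied_step) (use b_pos in \<open>simp add: policy_rate_def rate_off_diagonal\<close>)
  have arrive: "occupied x (Suc n, Suc i)" if "occupied x (n, Suc i)" for n i
    using that by (rule occupied_step) (use lam in \<open>simp add: policy_rate_def rate_off_diagonal\<close>)
  have serve: "occupied x (n, 0)" if "occupied x (Suc n, Suc 0)" for n
    using that by (rule occupied_step) (use mu in \<open>simp add: policy_rate_def rate_off_diagonal\<close>)
  have pos: "occupied x (n, Suc i)" for n i
  proof (induction n arbitrary: i)
    case 0
    show ?case by (induction i) (auto intro: up \<open>occupied x (0, 0)\<close>)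
  next
    case (Suc n)
    then show ?case by (rule arrive)
  qed
  have "occupied x (n, i)" for n i
    by (cases i) (auto intro: pos serve)
  then show ?thesis by (cases z) simp
qed

text \<open>The action enters affinely, so that minima over the action interval are attained at an end
  point.\<close>

lemma cost_drift_affine: "\<exists>p s. \<forall>a. r x a + drift q u a x = p + a * s"
proof (cases x)
  case (Pair n i)
  show ?thesis unfolding Pair drift_rate
    by (intro exI[of _ "cost c0 c1 c2 c3 S (n, i) 0 +
      (if 1 \<le> i then lam * (u (n + 1, i) - u (n, i)) else 0) +
      (if 1 \<le> n \<and> 1 \<le> i then mu * (u (n - 1, i - 1) - u (n, i)) else 0)"]
      exI[of _ "c2 * of_bool (S < i) + u (n, i + 1) - u (n, i)"]) (simp add: algebra_simps)
qed

lemma INF_cost_drift: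
  "(INF a\<in>A. r x a + drift q u a x) = min (r x \<gamma> + drift q u \<gamma> x) (r x R + drift q u R x)"
proof -
  obtain p s where ps: "\<And>a. r x a + drift q u a x = p + a * s"
    using cost_drift_affine by blast
  show ?thesis unfolding ps by (rule INF_affine[OF \<gamma>_le])
qed

lemma INF_cost_drift_le:
  assumes "a \<in> A"
  shows "(INF a\<in>A. r x a + drift q u a x) \<le> r x a + drift q u a x"
proof -
  obtain p s where ps: "\<And>a. r x a + drift q u a x = p + a * s"
    using cost_drift_affine by blast
  have "bdd_below ((\<lambda>a. p + a * s) ` A)"
    by (intro bounded_imp_bdd_below compact_imp_bounded compact_continuous_image continuous_intros) simp
  then show ?thesis unfolding ps using assms by (rule cINF_lower)
qed

end

section \<open>Solving the optimality equation\<close>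

context inventory
begin

lemma drift_cmult: "drift q (\<lambda>y. k * u y) a x = k * drift q u a x"
  by (cases x) (simp add: drift_rate algebra_simps)

lemma drift_diff: "drift q (\<lambda>y. u y - v y) a x = drift q u a x - drift q v a x"
  by (cases x) (simp add: drift_rate algebra_simps)

lemma uniformized_mono:
  assumes a: "a \<in> A" and le: "\<And>y. u y \<le> v y"
  shows "\<Lambda> * u x + drift q u a x \<le> \<Lambda> * v x + drift q v a x"
proof (cases x)
  case (Pair n i)
  define l where "l = (if 1 \<le> i then lam else 0)"
  define m where "m = (if 1 \<le> n \<and> 1 \<le> i then mu else 0)"
  have eq: "\<Lambda> * w x + drift q w a x = (\<Lambda> - a - l - m) * w (n, i) + a * w (n, i + 1) + l * w (n + 1, i) + m * w (n - 1, i - 1)" for w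
    unfolding Pair drift_rate l_def m_def by (auto simp: algebra_simps)
  show ?thesis unfolding eq
    using a \<gamma> lam mu by (intro add_mono mult_left_mono le) (auto simp: \<Lambda>_def l_def m_def)
qed

text \<open>The dynamic programming operator of the uniformized chain with gain \<open>g\<close> and value \<open>0\<close> prescribed
  at the origin.  A fixed point solves the optimality equation with constant \<open>g\<close> at all states other
  than the origin.\<close>

definition taboo_op :: "real \<Rightarrow> (state \<Rightarrow> real) \<Rightarrow> state \<Rightarrow> real" where
  "taboo_op g h x = (if x = (0, 0) then 0 else
     (\<Lambda> * h x + min (r x \<gamma> + drift q h \<gamma> x) (r x R + drift q h R x) - g) / \<Lambda>)"

text \<open>The contraction factor: off the origin, one step of the uniformized chain shrinks the mean
  of \<open>W\<close> at least by this factor.\<close>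

definition "\<rho> = 1 - cW / \<Lambda>"

lemma \<rho>: "0 \<le> \<rho>" "\<rho> < 1"
proof -
  have "\<Lambda> * 0 + drift q (\<lambda>_. 0) \<gamma> (0, 1) \<le> \<Lambda> * W (0, 1) + drift q W \<gamma> (0, 1)"
    using W_ge_1 by (intro uniformized_mono endpoints) (auto intro: order_trans[OF zero_le_one])
  then have "cW * W (0, 1) \<le> \<Lambda> * W (0, 1)"
    using drift_W[OF endpoints(1), of "(0, 1)"] by (simp add: drift_rate[of _ _ "\<lambda>_. 0"])
  then have "cW \<le> \<Lambda>" using W_ge_1[of "(0, 1)"] by simp
  then show "0 \<le> \<rho>" "\<rho> < 1" using \<Lambda>_pos constants by (auto simp: \<rho>_def)
qed

text \<open>Contraction in the weighted supremum norm, and Lipschitz dependence on the gain.\<close>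

lemma taboo_op_diff:
  assumes K: "0 \<le> K" and hh: "\<And>y. \<bar>h y - h' y\<bar> \<le> K * W y"
  shows "\<bar>taboo_op g h x - taboo_op g' h' x\<bar> \<le> \<rho> * K * W x + \<bar>g - g'\<bar> / \<Lambda>"
proof (cases "x = (0, 0)")
  case True
  then show ?thesis using K \<rho> W_ge_1[of x] \<Lambda>_pos by (simp add: taboo_op_def)
next
  case False
  have *: "\<bar>(\<Lambda> * h x + (r x a + drift q h a x)) - (\<Lambda> * h' x + (r x a + drift q h' a x))\<bar> \<le> \<Lambda> * (\<rho> * K * W x)"
    if a: "a \<in> A" for a
  proof -
    have "drift q W a x \<le> - cW * W x" using drift_W[OF a, of x] False by simp
    from mult_left_mono[OF this K]
    have "\<Lambda> * (K * W x) + drift q (\<lambda>y. K * W y) a x \<le> \<Lambda> * (K * W x) + K * (- cW * W x)"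
      unfolding drift_cmult by simp
    also have "\<dots> = \<Lambda> * (\<rho> * K * W x)" using \<Lambda>_pos by (simp add: \<rho>_def field_simps)
    finally have up: "\<Lambda> * (K * W x) + drift q (\<lambda>y. K * W y) a x \<le> \<Lambda> * (\<rho> * K * W x)" .
    have 1: "h y - h' y \<le> K * W y" "- (K * W y) \<le> h y - h' y" for y
      using hh[of y] by (auto simp: abs_le_iff)
    have "\<Lambda> * (h x - h' x) + drift q (\<lambda>y. h y - h' y) a x \<le> \<Lambda> * (K * W x) + drift q (\<lambda>y. K * W y) a x"
      by (intro uniformized_mono a 1)
    moreover have "\<Lambda> * ((-1) * (K * W x)) + drift q (\<lambda>y. (-1) * (K * W y)) a x \<le> \<Lambda> * (h x - h' x) + drift q (\<lambda>y. h y - h' y) a x"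
      using 1 by (intro uniformized_mono a) simp
    ultimately show ?thesis using up
      unfolding drift_diff drift_cmult[of "-1"] by (simp add: abs_le_iff algebra_simps)
  qed
  let ?m = "\<lambda>h. min (\<Lambda> * h x + (r x \<gamma> + drift q h \<gamma> x)) (\<Lambda> * h x + (r x R + drift q h R x))"
  have "\<bar>?m h - ?m h'\<bar> \<le> \<Lambda> * (\<rho> * K * W x)"
    by (intro abs_min_diff_le * endpoints)
  then have "\<bar>(?m h - g) - (?m h' - g')\<bar> \<le> \<Lambda> * (\<rho> * K * W x) + \<bar>g - g'\<bar>" by linarith
  then have "\<bar>(?m h - g) - (?m h' - g')\<bar> / \<Lambda> \<le> (\<Lambda> * (\<rho> * K * W x) + \<bar>g - g'\<bar>) / \<Lambda>"
    using \<Lambda>_pos by (intro divide_right_mono) auto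
  moreover have "taboo_op g h x - taboo_op g' h' x = ((?m h - g) - (?m h' - g')) / \<Lambda>"
    using False by (simp add: taboo_op_def min_add_distrib_right diff_divide_distrib)
  ultimately show ?thesis using \<Lambda>_pos by (simp add: abs_divide add_divide_distrib)
qed

lemma taboo_op_mono:
  assumes le: "\<And>y. h y \<le> h' y" and g: "g' \<le> g"
  shows "taboo_op g h x \<le> taboo_op g' h' x"
proof (cases "x = (0, 0)")
  case False
  let ?m = "\<lambda>h. min (\<Lambda> * h x + (r x \<gamma> + drift q h \<gamma> x)) (\<Lambda> * h x + (r x R + drift q h R x))"
  have "?m h \<le> ?m h'"
    using uniformized_mono[OF endpoints(1), of h h' x] uniformized_mono[OF endpoints(2), of h h' x] le
    by (intro min.mono) auto
  then have "(?m h - g) / \<Lambda> \<le> (?m h' - g') / \<Lambda>"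
    using g \<Lambda>_pos by (intro divide_right_mono) auto
  then show ?thesis using False by (simp add: taboo_op_def min_add_distrib_right diff_divide_distrib)
qed (simp add: taboo_op_def)

lemma taboo_op_zero_bound: "\<bar>taboo_op g (\<lambda>_. 0) x\<bar> \<le> (MW + \<bar>g\<bar>) / \<Lambda> * W x"
proof (cases "x = (0, 0)")
  case True
  then show ?thesis using constants W_ge_1[of x] \<Lambda>_pos by (simp add: taboo_op_def)
next
  case False
  have d0: "drift q (\<lambda>_. 0) a x = 0" for a by (cases x) (simp add: drift_rate)
  have "0 \<le> min (r x \<gamma>) (r x R)" using cost_nonneg endpoints by simp
  moreover have "min (r x \<gamma>) (r x R) \<le> MW * W x" using cost_le[OF endpoints(1), of x] by simp
  moreover have "\<bar>g\<bar> * 1 \<le> \<bar>g\<bar> * W x" using W_ge_1[of x] by (intro mult_left_mono) auto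
  ultimately have "\<bar>min (r x \<gamma>) (r x R) - g\<bar> \<le> MW * W x + \<bar>g\<bar> * W x" by linarith
  then have "\<bar>min (r x \<gamma>) (r x R) - g\<bar> \<le> (MW + \<bar>g\<bar>) * W x" by (simp only: distrib_right)
  then have "\<bar>min (r x \<gamma>) (r x R) - g\<bar> / \<Lambda> \<le> (MW + \<bar>g\<bar>) * W x / \<Lambda>"
    using \<Lambda>_pos by (intro divide_right_mono) auto
  then show ?thesis using False \<Lambda>_pos by (simp add: taboo_op_def d0 abs_divide)
qed

text \<open>Value iteration for the operator with gain \<open>g\<close>, started at zero.\<close>

definition iterate :: "real \<Rightarrow> nat \<Rightarrow> state \<Rightarrow> real" where
  "iterate g k = (taboo_op g ^^ k) (\<lambda>_. 0)"

lemma iterate_simps: "iterate g 0 = (\<lambda>_. 0)" "iterate g (Suc k) = taboo_op g (iterate g k)"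
  by (simp_all add: iterate_def)

text \<open>The norm of the first iterate is at most \<open>K\<^sub>0 g\<close>.\<close>

definition "K\<^sub>0 g = (MW + \<bar>g\<bar>) / \<Lambda>"

lemma K0_nonneg: "0 \<le> K\<^sub>0 g" using constants \<Lambda>_pos by (simp add: K\<^sub>0_def)

lemma iterate_step: "\<bar>iterate g (Suc k) x - iterate g k x\<bar> \<le> K\<^sub>0 g * \<rho> ^ k * W x"
proof (induction k arbitrary: x)
  case 0
  show ?case using taboo_op_zero_bound[of g x] by (simp add: iterate_simps K\<^sub>0_def)
next
  case (Suc k)
  have "\<bar>taboo_op g (iterate g (Suc k)) x - taboo_op g (iterate g k) x\<bar> \<le> \<rho> * (K\<^sub>0 g * \<rho> ^ k) * W x + \<bar>g - g\<bar> / \<Lambda>"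
    using K0_nonneg[of g] \<rho>(1) by (intro taboo_op_diff Suc.IH) simp
  then show ?case unfolding iterate_simps(2)[of g "Suc k"] by (simp add: iterate_simps(2)[of g k] mult_ac)
qed

lemma iterate_bound: "\<bar>iterate g k x\<bar> \<le> K\<^sub>0 g / (1 - \<rho>) * W x"
proof (induction k arbitrary: x)
  case 0
  show ?case using K0_nonneg \<rho> W_ge_1[of x] by (simp add: iterate_simps)
next
  case (Suc k)
  define B where "B = K\<^sub>0 g / (1 - \<rho>)"
  have B: "0 \<le> B" "K\<^sub>0 g = B * (1 - \<rho>)" using K0_nonneg \<rho> by (auto simp: B_def)
  have "\<bar>taboo_op g (iterate g k) x - taboo_op g (\<lambda>_. 0) x\<bar> \<le> \<rho> * B * W x + \<bar>g - g\<bar> / \<Lambda>"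
  proof (rule taboo_op_diff[OF B(1)])
    show "\<bar>iterate g k y - 0\<bar> \<le> B * W y" for y using Suc.IH[of y] by (simp add: B_def)
  qed
  then have "\<bar>taboo_op g (iterate g k) x - taboo_op g (\<lambda>_. 0) x\<bar> \<le> \<rho> * B * W x" by simp
  moreover have "\<bar>taboo_op g (\<lambda>_. 0) x\<bar> \<le> B * (1 - \<rho>) * W x"
    using taboo_op_zero_bound[of g x] unfolding B(2)[symmetric] K\<^sub>0_def .
  ultimately have "\<bar>taboo_op g (iterate g k) x\<bar> \<le> \<rho> * B * W x + B * (1 - \<rho>) * W x" by linarith
  also have "\<dots> = B * W x" by (simp add: algebra_simps)
  finally show ?case by (simp add: iterate_simps B_def)
qed

lemma iterate_lipschitz: "\<bar>iterate g k x - iterate g' k x\<bar> \<le> \<bar>g - g'\<bar> / \<Lambda> / (1 - \<rho>) * W x"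
proof (induction k arbitrary: x)
  case 0
  show ?case using \<Lambda>_pos \<rho> W_ge_1[of x] by (simp add: iterate_simps)
next
  case (Suc k)
  define D where "D = \<bar>g - g'\<bar> / \<Lambda>"
  define B where "B = D / (1 - \<rho>)"
  have B: "0 \<le> B" "D = B * (1 - \<rho>)" "0 \<le> D" using \<Lambda>_pos \<rho> by (auto simp: B_def D_def)
  have "\<bar>taboo_op g (iterate g k) x - taboo_op g' (iterate g' k) x\<bar> \<le> \<rho> * B * W x + D"
    unfolding D_def by (rule taboo_op_diff[OF B(1)]) (unfold B_def D_def, rule Suc.IH)
  also have "D * 1 \<le> D * W x" using B W_ge_1[of x] by (intro mult_left_mono) auto
  then have "\<rho> * B * W x + D \<le> \<rho> * B * W x + B * (1 - \<rho>) * W x" using B(2) by simp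
  also have "\<dots> = B * W x" by (simp add: algebra_simps)
  finally show ?case by (simp add: iterate_simps B_def D_def)
qed

lemma iterate_mono: "g' \<le> g \<Longrightarrow> iterate g k x \<le> iterate g' k x"
  by (induction k arbitrary: x) (auto simp: iterate_simps intro!: taboo_op_mono)

lemma iterate_nonneg: "0 \<le> iterate 0 k x"
proof (induction k arbitrary: x)
  case (Suc k)
  have d0: "drift q (\<lambda>_. 0) a x = 0" for a by (cases x) (simp add: drift_rate)
  have "0 \<le> taboo_op 0 (\<lambda>_. 0) x"
    using cost_nonneg[OF endpoints(1), of x] cost_nonneg[OF endpoints(2), of x] \<Lambda>_pos by (simp add: taboo_op_def d0)
  also have "\<dots> \<le> taboo_op 0 (iterate 0 k) x" by (rule taboo_op_mono) (auto intro: Suc.IH)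
  finally show ?case by (simp add: iterate_simps)
qed (simp add: iterate_simps)

text \<open>The fixed point of the operator with gain \<open>g\<close>, as the limit of value iteration.\<close>

definition bias :: "real \<Rightarrow> state \<Rightarrow> real" where
  "bias g x = lim (\<lambda>k. iterate g k x)"

lemma iterate_tendsto: "(\<lambda>k. iterate g k x) \<longlonglongrightarrow> bias g x"
proof -
  have "summable (\<lambda>k. iterate g (Suc k) x - iterate g k x)"
  proof (rule summable_comparison_test')
    show "summable (\<lambda>k. K\<^sub>0 g * W x * \<rho> ^ k)"
      using \<rho> by (intro summable_mult summable_geometric) auto
    show "norm (iterate g (Suc k) x - iterate g k x) \<le> K\<^sub>0 g * W x * \<rho> ^ k" for k
      using iterate_step[of g k x] by (simp add: mult_ac)
  qed
  then have "convergent (\<lambda>k. \<Sum>j<k. iterate g (Suc j) x - iterate g j x)"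
    by (simp add: summable_iff_convergent)
  moreover have "(\<Sum>j<k. iterate g (Suc j) x - iterate g j x) = iterate g k x" for k
    using sum_lessThan_telescope[of "\<lambda>k. iterate g k x" k] by (simp only: iterate_simps(1) diff_0_right)
  ultimately have "convergent (\<lambda>k. iterate g k x)" by simp
  then show ?thesis by (simp add: bias_def convergent_LIMSEQ_iff)
qed

lemma drift_tendsto:
  assumes "\<And>y. ((\<lambda>k. f k y) \<longlongrightarrow> h y) F"
  shows "((\<lambda>k. drift q (f k) a x) \<longlongrightarrow> drift q h a x) F"
  by (cases x) (auto simp: drift_rate intro!: tendsto_intros assms)

lemma bias_fixed_point: "taboo_op g (bias g) x = bias g x"
proof (rule LIMSEQ_unique)
  show "(\<lambda>k. iterate g (Suc k) x) \<longlonglongrightarrow> bias g x"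
    using iterate_tendsto by (rule LIMSEQ_Suc)
  show "(\<lambda>k. iterate g (Suc k) x) \<longlonglongrightarrow> taboo_op g (bias g) x"
    unfolding iterate_simps taboo_op_def using \<Lambda>_pos
    by (auto intro!: tendsto_intros tendsto_min drift_tendsto iterate_tendsto)
qed

lemma bias_in_weighted_space: "bias g \<in> weighted_space W"
proof -
  have "\<bar>bias g x\<bar> \<le> K\<^sub>0 g / (1 - \<rho>) * W x" for x
    by (rule Lim_bounded[OF tendsto_rabs[OF iterate_tendsto]]) (use iterate_bound in auto)
  then have "\<bar>bias g x\<bar> / W x \<le> K\<^sub>0 g / (1 - \<rho>)" for x
    using W_ge_1[of x] by (simp add: pos_divide_le_eq)
  then show ?thesis unfolding weighted_space_def by (intro CollectI bdd_aboveI2)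
qed

lemma bias_continuous: "isCont (\<lambda>g. bias g x) g0"
proof -
  have L: "\<bar>bias g x - bias g' x\<bar> \<le> \<bar>g - g'\<bar> / \<Lambda> / (1 - \<rho>) * W x" for g g'
    by (rule Lim_bounded[OF tendsto_rabs[OF tendsto_diff[OF iterate_tendsto iterate_tendsto]]])
      (use iterate_lipschitz in auto)
  have "((\<lambda>g. bias g x - bias g0 x) \<longlongrightarrow> 0) (at g0)"
  proof (rule Lim_null_comparison)
    show "\<forall>\<^sub>F g in at g0. norm (bias g x - bias g0 x) \<le> \<bar>g - g0\<bar> / \<Lambda> / (1 - \<rho>) * W x"
      using L by (intro always_eventually) simp
    have "((\<lambda>g. \<bar>g - g0\<bar> / \<Lambda> / (1 - \<rho>) * W x) \<longlongrightarrow> \<bar>g0 - g0\<bar> / \<Lambda> / (1 - \<rho>) * W x) (at g0)"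
      using \<Lambda>_pos \<rho> by (intro tendsto_intros) auto
    then show "((\<lambda>g. \<bar>g - g0\<bar> / \<Lambda> / (1 - \<rho>) * W x) \<longlongrightarrow> 0) (at g0)" by simp
  qed
  then show ?thesis unfolding isCont_def by (simp add: LIM_zero_iff)
qed

lemma bias_mono: "g' \<le> g \<Longrightarrow> bias g x \<le> bias g' x"
  by (rule LIMSEQ_le[OF iterate_tendsto iterate_tendsto]) (auto intro: iterate_mono)

lemma bias_0_nonneg: "0 \<le> bias 0 x"
  by (rule LIMSEQ_le_const[OF iterate_tendsto]) (auto intro: iterate_nonneg)

lemma bias_origin: "bias g (0, 0) = 0"
  using bias_fixed_point[of g "(0, 0)"] by (simp add: taboo_op_def)

text \<open>The right-hand side of the optimality equation, written as a minimum over the two end points of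
  the action interval.\<close>

definition min_cost :: "(state \<Rightarrow> real) \<Rightarrow> state \<Rightarrow> real" where
  "min_cost h x = min (r x \<gamma> + drift q h \<gamma> x) (r x R + drift q h R x)"

lemma min_cost_bias:
  assumes "x \<noteq> (0, 0)"
  shows "min_cost (bias g) x = g"
  using bias_fixed_point[of g x] assms \<Lambda>_pos by (simp add: taboo_op_def min_cost_def field_simps)

text \<open>The equation at the origin fixes the gain: the difference of its two sides depends continuously
  on \<open>g\<close> and is some \<open>d \<ge> 0\<close> for \<open>g = 0\<close>; since the fixed points decrease in \<open>g\<close>, it is nonpositive
  for \<open>g = d\<close>.\<close>

lemma ex_balanced_gain: "\<exists>g. min_cost (bias g) (0, 0) = g"
proof -
  define \<phi> where "\<phi> g = min_cost (bias g) (0, 0) - g" for g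
  have cont: "isCont \<phi> g" for g
    unfolding \<phi>_def min_cost_def isCont_def
    by (intro tendsto_intros tendsto_min drift_tendsto) (rule bias_continuous[unfolded isCont_def])+
  have drift0: "drift q (bias g) a (0, 0) = a * bias g (0, 1)" for g a
    by (simp add: drift_rate bias_origin)
  have "0 \<le> \<phi> 0"
    using cost_nonneg[OF endpoints(1), of "(0, 0)"] cost_nonneg[OF endpoints(2), of "(0, 0)"]
      bias_0_nonneg[of "(0, 1)"] \<gamma> \<gamma>_le
    by (simp add: \<phi>_def min_cost_def drift0)
  have "\<phi> (\<phi> 0) \<le> 0"
  proof -
    have "bias (\<phi> 0) (0, 1) \<le> bias 0 (0, 1)" by (rule bias_mono) fact
    then have "min_cost (bias (\<phi> 0)) (0, 0) \<le> min_cost (bias 0) (0, 0)"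
      unfolding min_cost_def drift0 using \<gamma> \<gamma>_le by (intro min.mono add_left_mono mult_left_mono) auto
    then show ?thesis by (simp add: \<phi>_def)
  qed
  from IVT2[OF this \<open>0 \<le> \<phi> 0\<close> \<open>0 \<le> \<phi> 0\<close>] cont
  obtain g where "\<phi> g = 0" by auto
  then show ?thesis by (auto simp: \<phi>_def)
qed

theorem ex_ACOE: "\<exists>g. \<exists>u\<in>weighted_space W. \<exists>\<beta>\<in>policies A. ACOE q r A g u \<beta>"
proof -
  obtain g where g: "min_cost (bias g) (0, 0) = g" using ex_balanced_gain by blast
  have all: "min_cost (bias g) x = g" for x
    using g min_cost_bias[of x g] by (cases "x = (0, 0)") auto
  have inf: "(INF a\<in>A. r x a + drift q (bias g) a x) = g" for x
    using all[of x] by (simp add: INF_cost_drift min_cost_def)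
  define \<beta> where "\<beta> x = (if r x \<gamma> + drift q (bias g) \<gamma> x \<le> r x R + drift q (bias g) R x then \<gamma> else R)" for x
  have "r x (\<beta> x) + drift q (bias g) (\<beta> x) x = g" for x
    using all[of x] by (auto simp: \<beta>_def min_cost_def min_def split: if_splits)
  then have "ACOE q r A g (bias g) \<beta>" by (simp add: ACOE_def realizes_minimum_def inf)
  moreover have "\<beta> \<in> policies A" unfolding policies_def \<beta>_def using endpoints by simp
  ultimately show ?thesis using bias_in_weighted_space by blast
qed

end

section \<open>Pathwise average cost optimality\<close>

context inventory
begin

lemma pathwise_cost_le:
  assumes \<beta>: "\<beta> \<in> policies A" and u: "u \<in> weighted_space W"
    and le: "\<And>y. r y (\<beta> y) + drift q u (\<beta> y) y \<le> g"
  shows "AE \<omega> in path_measure (policy_rate q \<beta>). pathwise_cost q r \<beta> x \<omega> \<le> ereal g"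
  by (rule policy_chain.pathwise_cost_le[OF policy_chain[OF \<beta>] u]) (rule le)

lemma ACOE_D:
  assumes "ACOE q r A g u \<beta>"
  shows "(INF a\<in>A. r x a + drift q u a x) = g" "r x (\<beta> x) + drift q u (\<beta> x) x = g"
  using assms unfolding ACOE_def realizes_minimum_def by metis+

lemma ACOE_gain_le:
  assumes acoe: "ACOE q r A g u \<beta>'" and "a \<in> A"
  shows "g \<le> r x a + drift q u a x"
  using INF_cost_drift_le[OF \<open>a \<in> A\<close>, of x u] by (simp only: ACOE_D(1)[OF acoe])

lemma pathwise_cost_ge_ACOE:
  assumes \<beta>: "\<beta> \<in> policies A" and u: "u \<in> weighted_space W"
    and acoe: "ACOE q r A g u \<beta>'"
  shows "AE \<omega> in path_measure (policy_rate q \<beta>). ereal g \<le> pathwise_cost q r \<beta> x \<omega>"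
proof -
  have "AE \<omega> in path_measure (policy_rate q \<beta>). \<exists>\<kappa>>0. ereal (g + 0 * \<kappa>) \<le> pathwise_cost q r \<beta> x \<omega>"
    using ACOE_gain_le[OF acoe policiesD[OF \<beta>]]
    by (intro policy_chain.pathwise_cost_ge_occupied[OF policy_chain[OF \<beta>] u _ occupied_all[OF \<beta>, of x x]]) auto
  then show ?thesis by eventually_elim auto
qed

lemma eps_PAC_optimal_of_ACOE:
  assumes u: "u \<in> weighted_space W" and acoe: "ACOE q r A g u \<beta>"
    and \<beta>': "\<beta>' \<in> policies A" and u': "u' \<in> weighted_space W"
    and le: "\<And>x. r x (\<beta>' x) + drift q u' (\<beta>' x) x \<le> g + \<epsilon>"
  shows "eps_PAC_optimal q r A \<epsilon> \<beta>'"
  unfolding eps_PAC_optimal_def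
proof (intro conjI exI[of _ g] allI ballI \<beta>')
  show "AE \<omega> in path_measure (policy_rate q \<beta>'). pathwise_cost q r \<beta>' x \<omega> \<le> ereal (g + \<epsilon>)" for x
    by (rule pathwise_cost_le[OF \<beta>' u' le])
  show "AE \<omega> in path_measure (policy_rate q \<beta>''). ereal g \<le> pathwise_cost q r \<beta>'' x \<omega>"
    if "\<beta>'' \<in> policies A" for \<beta>'' x
    by (rule pathwise_cost_ge_ACOE[OF that u acoe])
qed

lemma ACOE_pathwise_cost_le:
  assumes \<beta>: "\<beta> \<in> policies A" and u: "u \<in> weighted_space W" and acoe: "ACOE q r A g u \<beta>"
  shows "AE \<omega> in path_measure (policy_rate q \<beta>). pathwise_cost q r \<beta> x \<omega> \<le> ereal g"
  by (rule pathwise_cost_le[OF \<beta> u]) (simp only: ACOE_D(2)[OF acoe])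

lemma AE_path_measure_witness:
  assumes "\<beta> \<in> policies A" "AE \<omega> in path_measure (policy_rate q \<beta>). P"
  shows P
proof -
  interpret policy_chain q r \<beta> \<gamma> \<Lambda> W V bW cV bV MV by (rule policy_chain[OF assms(1)])
  show P using assms(2) unfolding path_measure_eq by (simp only: paths.AE_const)
qed

lemma ACOE_gain_unique:
  assumes "u \<in> weighted_space W" "\<beta> \<in> policies A" "ACOE q r A g u \<beta>"
    and "u' \<in> weighted_space W" "\<beta>' \<in> policies A" "ACOE q r A g' u' \<beta>'"
  shows "g \<le> g'"
proof (rule AE_path_measure_witness[OF \<open>\<beta>' \<in> policies A\<close>])
  show "AE \<omega> in path_measure (policy_rate q \<beta>'). g \<le> g'"
    using ACOE_pathwise_cost_le[OF assms(5,4,6), of "(0, 0)"] pathwise_cost_ge_ACOE[OF assms(5,1,3), of "(0, 0)"]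
  proof eventually_elim
    case (elim \<omega>)
    from order_trans[OF elim(2,1)] show ?case by simp
  qed
qed

text \<open>If the minimum were missed at \<open>z\<close>, the positive fraction of time spent in \<open>z\<close> would raise the
  pathwise cost strictly above \<open>g\<close>, which the policy \<open>\<beta>\<close> attains.\<close>

lemma PAC_optimal_realizes_minimum:
  assumes \<beta>: "\<beta> \<in> policies A" and u: "u \<in> weighted_space W" and acoe: "ACOE q r A g u \<beta>"
    and opt: "PAC_optimal q r A \<beta>'"
  shows "realizes_minimum q r A u \<beta>'"
proof (rule ccontr)
  have \<beta>': "\<beta>' \<in> policies A" using opt by (simp add: eps_PAC_optimal_def)
  assume "\<not> realizes_minimum q r A u \<beta>'"
  then obtain z where "(INF a\<in>A. r z a + drift q u a z) \<noteq> r z (\<beta>' z) + drift q u (\<beta>' z) z"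
    unfolding realizes_minimum_def by blast
  then have "g \<noteq> r z (\<beta>' z) + drift q u (\<beta>' z) z" unfolding ACOE_D(1)[OF acoe] .
  then have z: "g < r z (\<beta>' z) + drift q u (\<beta>' z) z"
    using ACOE_gain_le[OF acoe policiesD[OF \<beta>'], of z z] by linarith
  define d where "d = r z (\<beta>' z) + drift q u (\<beta>' z) z - g"
  have d: "0 < d" using z by (simp add: d_def)
  obtain g' where g': "\<And>x. AE \<omega> in path_measure (policy_rate q \<beta>'). pathwise_cost q r \<beta>' x \<omega> \<le> ereal (g' + 0)"
    "\<And>\<beta> x. \<beta> \<in> policies A \<Longrightarrow> AE \<omega> in path_measure (policy_rate q \<beta>). pathwise_cost q r \<beta> x \<omega> \<ge> ereal g'"
    using opt unfolding eps_PAC_optimal_def by blast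
  have "g' \<le> g"
  proof (rule AE_path_measure_witness[OF \<beta>])
    show "AE \<omega> in path_measure (policy_rate q \<beta>). g' \<le> g"
      using ACOE_pathwise_cost_le[OF \<beta> u acoe, of z] g'(2)[OF \<beta>, of z]
    proof eventually_elim
      case (elim \<omega>)
      from order_trans[OF elim(2,1)] show ?case by simp
    qed
  qed
  have "AE \<omega> in path_measure (policy_rate q \<beta>'). \<exists>\<kappa>>0. ereal (g + d * \<kappa>) \<le> pathwise_cost q r \<beta>' z \<omega>"
  proof (rule policy_chain.pathwise_cost_ge_occupied[OF policy_chain[OF \<beta>'] u _ occupied_all[OF \<beta>']])
    show "0 \<le> d" using d by simp
    show "g + d * of_bool (y = z) \<le> r y (\<beta>' y) + drift q u (\<beta>' y) y" for y
    proof (cases "y = z")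
      case False
      then show ?thesis using ACOE_gain_le[OF acoe policiesD[OF \<beta>'], of y y] by simp
    qed (simp add: d_def)
  qed
  with g'(1)[of z] have "AE \<omega> in path_measure (policy_rate q \<beta>'). False"
  proof eventually_elim
    case (elim \<omega>)
    then obtain \<kappa> where \<kappa>: "0 < \<kappa>" "ereal (g + d * \<kappa>) \<le> pathwise_cost q r \<beta>' z \<omega>" by blast
    from order_trans[OF \<kappa>(2) elim(1)] have "g + d * \<kappa> \<le> g'" by simp
    moreover have "0 < d * \<kappa>" using d \<kappa> by simp
    ultimately show False using \<open>g' \<le> g\<close> by simp
  qed
  then show False by (rule AE_path_measure_witness[OF \<beta>'])
qed

end

theorem theorem6p1:
  fixes lam mu \<gamma> R c0 c1 c2 c3 :: real and S :: nat and W :: "state \<Rightarrow> real"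
    and q :: "real \<Rightarrow> state \<Rightarrow> state \<Rightarrow> real" and r :: "state \<Rightarrow> real \<Rightarrow> real" and A :: "real set"
  assumes "lam > 0" and "mu > 0" and "0 < \<gamma>" and "\<gamma> \<le> R"
    and "c0 \<ge> 0" and "c1 \<ge> 0" and "c2 \<ge> 0" and "c3 \<ge> 0"
    and "q = rate lam mu" and "r = cost c0 c1 c2 c3 S" and "A = {\<gamma>..R}"
    and "assumption_I q r A W" and "assumption_II q A W"
    and "assumption_III q A W" and "assumption_IV q A W"
  shows "(\<exists>!g. \<exists>u\<in>weighted_space W. \<exists>\<beta>\<in>policies A. ACOE q r A g u \<beta>) \<and>
    (\<forall>g. \<forall>u\<in>weighted_space W. \<forall>\<beta>\<in>policies A. ACOE q r A g u \<beta> \<longrightarrow>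
       (PAC_optimal q r A \<beta> \<and>
          (\<forall>x. AE \<omega> in path_measure (policy_rate q \<beta>). pathwise_cost q r \<beta> x \<omega> = ereal g)) \<and>
       (\<forall>\<beta>'\<in>policies A. PAC_optimal q r A \<beta>' \<longleftrightarrow> realizes_minimum q r A u \<beta>') \<and>
       (\<forall>\<epsilon>\<ge>0. \<forall>\<beta>'\<in>policies A.
          (\<exists>u'\<in>weighted_space W. \<forall>x. g \<ge> r x (\<beta>' x) + drift q u' (\<beta>' x) x - \<epsilon>) \<longrightarrow>
          eps_PAC_optimal q r A \<epsilon> \<beta>'))"
proof -
  note q = \<open>q = rate lam mu\<close> and r = \<open>r = cost c0 c1 c2 c3 S\<close> and A = \<open>A = {\<gamma>..R}\<close>
  have W_ge_1: "1 \<le> W x" for x using \<open>assumption_I q r A W\<close> unfolding assumption_I_def by blast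
  obtain cW bW MW where W: "0 < cW" "0 \<le> bW" "0 < MW"
      "\<And>x a. a \<in> A \<Longrightarrow> drift q W a x \<le> - cW * W x + bW * of_bool (x = (0, 0))"
      "\<And>x a. a \<in> A \<Longrightarrow> r x a \<le> MW * W x"
    using \<open>assumption_I q r A W\<close> unfolding assumption_I_def by metis
  obtain V cV bV MV where V: "\<And>x. 1 \<le> V x" "0 < cV" "0 \<le> bV" "0 < MV"
      "\<And>x a. a \<in> A \<Longrightarrow> (W x)\<^sup>2 \<le> MV * V x"
      "\<And>x a. a \<in> A \<Longrightarrow> drift q V a x \<le> - cV * V x + bV"
    using \<open>assumption_IV q A W\<close> unfolding assumption_IV_def by metis
  have "\<gamma> \<in> A" using A \<open>\<gamma> \<le> R\<close> by simp
  interpret inventory lam mu \<gamma> R c0 c1 c2 c3 S W V cW bW MW cV bV MV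
    by unfold_locales
      (use assms(1-8) W_ge_1 W V V(5)[OF \<open>\<gamma> \<in> A\<close>] in \<open>simp_all only: q r A\<close>)
  show ?thesis
    unfolding q r A
  proof (intro conjI allI ballI impI)
    show "\<exists>!g. \<exists>u\<in>weighted_space W. \<exists>\<beta>\<in>policies {\<gamma>..R}. ACOE (rate lam mu) (cost c0 c1 c2 c3 S) {\<gamma>..R} g u \<beta>"
      using ex_ACOE by (rule ex_ex1I) (blast intro: antisym ACOE_gain_unique)
  next
    fix g u \<beta> assume u: "u \<in> weighted_space W" and \<beta>: "\<beta> \<in> policies {\<gamma>..R}"
      and acoe: "ACOE (rate lam mu) (cost c0 c1 c2 c3 S) {\<gamma>..R} g u \<beta>"
    have optI: "PAC_optimal (rate lam mu) (cost c0 c1 c2 c3 S) {\<gamma>..R} \<beta>'"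
      if "\<beta>' \<in> policies {\<gamma>..R}" "realizes_minimum (rate lam mu) (cost c0 c1 c2 c3 S) {\<gamma>..R} u \<beta>'" for \<beta>'
    proof (rule eps_PAC_optimal_of_ACOE[OF u acoe that(1) u])
      have "ACOE (rate lam mu) (cost c0 c1 c2 c3 S) {\<gamma>..R} g u \<beta>'"
        using acoe that(2) unfolding ACOE_def by blast
      from ACOE_D(2)[OF this]
      show "cost c0 c1 c2 c3 S x (\<beta>' x) + drift (rate lam mu) u (\<beta>' x) x \<le> g + 0" for x
        by simp
    qed
    show "PAC_optimal (rate lam mu) (cost c0 c1 c2 c3 S) {\<gamma>..R} \<beta>"
      using acoe unfolding ACOE_def by (blast intro: optI \<beta>)
    show "AE \<omega> in path_measure (policy_rate (rate lam mu) \<beta>).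
        pathwise_cost (rate lam mu) (cost c0 c1 c2 c3 S) \<beta> x \<omega> = ereal g" for x
      using ACOE_pathwise_cost_le[OF \<beta> u acoe, of x] pathwise_cost_ge_ACOE[OF \<beta> u acoe, of x]
      by eventually_elim (rule antisym)
    fix \<beta>' assume \<beta>': "\<beta>' \<in> policies {\<gamma>..R}"
    show "PAC_optimal (rate lam mu) (cost c0 c1 c2 c3 S) {\<gamma>..R} \<beta>' \<longleftrightarrow>
        realizes_minimum (rate lam mu) (cost c0 c1 c2 c3 S) {\<gamma>..R} u \<beta>'"
      using optI[OF \<beta>'] PAC_optimal_realizes_minimum[OF \<beta> u acoe] by blast
    fix \<epsilon> :: real assume "\<exists>u'\<in>weighted_space W. \<forall>x. g \<ge> cost c0 c1 c2 c3 S x (\<beta>' x) + drift (rate lam mu) u' (\<beta>' x) x - \<epsilon>"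
    then obtain u' where u': "u' \<in> weighted_space W"
        "\<And>x. g \<ge> cost c0 c1 c2 c3 S x (\<beta>' x) + drift (rate lam mu) u' (\<beta>' x) x - \<epsilon>" by blast
    show "eps_PAC_optimal (rate lam mu) (cost c0 c1 c2 c3 S) {\<gamma>..R} \<epsilon> \<beta>'"
    proof (rule eps_PAC_optimal_of_ACOE[OF u acoe \<beta>' u'(1)])
      fix x
      show "cost c0 c1 c2 c3 S x (\<beta>' x) + drift (rate lam mu) u' (\<beta>' x) x \<le> g + \<epsilon>"
        using u'(2)[of x] by linarith
    qed
  qed
qed

end
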